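(* Let $\overline{\alpha}_n$ be the integrated empirical process built on an i.i.d. sequence of real random variables with continuous distribution function. Then $$\limsup_{n\to\infty}\frac{\sup_{t\in\mathbb{R}}\left|\overline{\alpha}_n(t)\right|}{\sqrt{\log\log n}}=\frac{3\sqrt{3}}{8\sqrt{2}}\quad\text{almost surely.}$$
   Context: $\{X_i:i\in\mathbb{N}^*\}$ is a sequence of i.i.d. real random variables with continuous distribution function $F$. For $n\in\mathbb{N}^*=\{1,2,\dots\}$ and $t\in\mathbb{R}$: $\mathbb{F}_n(t)=\frac1n\sum_{i=1}^n\mathbf{1}_{\{X_i\leq t\}}$, $\overline{\mathbb{F}}_n(t)=\int_{-\infty}^t\mathbb{F}_n(s)\,d\mathbb{F}_n(s)$ (i.e. $\frac1n\sum_{j=1}^n\mathbb{F}_n(X_j)\mathbf{1}_{\{X_j\leq t\}}$), $\overline{F}(t)=\int_{-\infty}^tF(s)\,dF(s)=\frac12F(t)^2$, and $\overline{\alpha}_n(t)=\sqrt{n}\,(\overline{\mathbb{F}}_n(t)-\overline{F}(t))$. *)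

theory Defs
  imports "HOL-Probability.Probability"
begin

text \<open>Observations are indexed from \<open>1\<close>, so \<open>X 0\<close> plays no role.\<close>

definition empirical_cdf :: "(nat \<Rightarrow> 'a \<Rightarrow> real) \<Rightarrow> nat \<Rightarrow> 'a \<Rightarrow> real \<Rightarrow> real" where
  "empirical_cdf X n \<omega> t = (1 / real n) * (\<Sum>i = 1..n. indicator {..t} (X i \<omega>))"

text \<open>
  The Lebesgue--Stieltjes integral of \<open>G\<close> over \<open>(-\<infinity>, t]\<close> against \<open>dG\<close>. The measure \<open>interval_measure G\<close>
  is the Stieltjes measure of \<open>G\<close> whenever \<open>G\<close> is nondecreasing and right-continuous.
\<close>

definition integrated_df :: "(real \<Rightarrow> real) \<Rightarrow> real \<Rightarrow> real" where
  "integrated_df G t = (LINT s:{..t}|interval_measure G. G s)"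

definition integrated_emp_process ::
  "(nat \<Rightarrow> 'a \<Rightarrow> real) \<Rightarrow> (real \<Rightarrow> real) \<Rightarrow> nat \<Rightarrow> 'a \<Rightarrow> real \<Rightarrow> real" where
  "integrated_emp_process X F n \<omega> t =
     sqrt (real n) * (integrated_df (empirical_cdf X n \<omega>) t - integrated_df F t)"

text \<open>
  The rest of the theory shows that these definitions are not degenerate: for a continuous
  distribution function \<open>F\<close> the Stieltjes integral is \<open>F(t)\<^sup>2 / 2\<close>, for the empirical distribution
  function it is the expected finite sum, and the real-valued supremum of the process over \<open>t\<close> is
  taken over a bounded set.
\<close>

lemma (in real_distribution) interval_measure_cdf: "interval_measure (cdf M) = M"
proof (rule cdf_unique)
  show "real_distribution (interval_measure (cdf M))"
    by (intro real_distribution_interval_measure cdf_nondecreasing cdf_is_right_cont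
        cdf_lim_at_bot cdf_lim_at_top_prob)
  show "cdf (interval_measure (cdf M)) = cdf M"
    by (intro cdf_interval_measure cdf_nondecreasing cdf_is_right_cont cdf_lim_at_bot)
qed unfold_locales

lemma (in real_distribution) integrated_df_cdf:
  "integrated_df (cdf M) t = (LINT s:{..t}|M. cdf M s)"
  by (simp add: integrated_df_def interval_measure_cdf)

lemma (in real_distribution) cdf_borel [measurable]: "cdf M \<in> borel_measurable borel"
  by (intro borel_measurable_mono monoI cdf_nondecreasing)

lemma (in real_distribution) integrated_df_cdf_nonneg: "0 \<le> integrated_df (cdf M) t"
  unfolding integrated_df_cdf set_lebesgue_integral_def
  by (intro Bochner_Integration.integral_nonneg) (simp add: cdf_nonneg)

lemma (in real_distribution) integrated_df_cdf_le_1: "integrated_df (cdf M) t \<le> 1"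
  unfolding integrated_df_cdf set_lebesgue_integral_def
proof (rule integral_le_const)
  show "integrable M (\<lambda>x. indicat_real {..t} x *\<^sub>R cdf M x)"
    by (rule integrable_const_bound[where B=1])
       (auto simp: cdf_nonneg cdf_bounded_prob split: split_indicator)
qed (auto simp: cdf_bounded_prob split: split_indicator)

lemma (in real_distribution) integrated_df_continuous_cdf:
  assumes "continuous_on UNIV (cdf M)"
  shows "integrated_df (cdf M) t = (cdf M t)\<^sup>2 / 2"
proof -
  interpret P: pair_prob_space M M ..
  have atom: "measure M {x} = 0" for x
    using assms isCont_cdf[of x] by (simp add: continuous_on_eq_continuous_at)
  have lt: "measure M {..<x} = cdf M x" for x
  proof -
    have "measure M ({..<x} \<union> {x}) = measure M {..<x} + measure M {x}"
      by (intro finite_measure_Union) auto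
    then show ?thesis
      by (simp only: ivl_disj_un_singleton(2) atom cdf_def add_0_right)
  qed
  let ?I = "\<integral>\<^sup>+ s. ennreal (indicator {..t} s * cdf M s) \<partial>M"
  let ?A = "{z \<in> space (M \<Otimes>\<^sub>M M). fst z \<le> snd z \<and> snd z \<le> t}"
  let ?B = "{z \<in> space (M \<Otimes>\<^sub>M M). snd z < fst z \<and> fst z \<le> t}"
  have [measurable]: "(\<lambda>x. x) \<in> borel_measurable M"
    by simp
  have [measurable]: "fst \<in> borel_measurable (M \<Otimes>\<^sub>M M)" "snd \<in> borel_measurable (M \<Otimes>\<^sub>M M)"
    using measurable_compose[OF measurable_fst, of "\<lambda>x. x" M borel M]
      measurable_compose[OF measurable_snd, of "\<lambda>x. x" M borel M] by simp_all
  have A: "?A \<in> sets (M \<Otimes>\<^sub>M M)"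
    by (intro sets.sets_Collect_conj borel_measurable_le) auto
  have B: "?B \<in> sets (M \<Otimes>\<^sub>M M)"
    by (intro sets.sets_Collect_conj borel_measurable_le borel_measurable_less) auto
  have "emeasure (M \<Otimes>\<^sub>M M) ?A = ?I"
    unfolding P.emeasure_pair_measure_alt2[OF A]
  proof (intro nn_integral_cong)
    fix s
    have "(\<lambda>r. (r, s)) -` ?A = (if s \<le> t then {..s} else {})"
      by (auto simp: space_pair_measure)
    then show "emeasure M ((\<lambda>r. (r, s)) -` ?A) = ennreal (indicator {..t} s * cdf M s)"
      by (simp add: cdf_def emeasure_eq_measure)
  qed
  moreover have "emeasure (M \<Otimes>\<^sub>M M) ?B = ?I"
    unfolding emeasure_pair_measure_alt[OF B]
  proof (intro nn_integral_cong)
    fix r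
    have "Pair r -` ?B = (if r \<le> t then {..<r} else {})"
      by (auto simp: space_pair_measure)
    then show "emeasure M (Pair r -` ?B) = ennreal (indicator {..t} r * cdf M r)"
      by (simp add: lt emeasure_eq_measure)
  qed
  moreover have "emeasure (M \<Otimes>\<^sub>M M) (?A \<union> ?B) = emeasure (M \<Otimes>\<^sub>M M) ?A + emeasure (M \<Otimes>\<^sub>M M) ?B"
    by (rule plus_emeasure[OF A B, symmetric]) fastforce
  moreover have "?A \<union> ?B = {..t} \<times> {..t}"
    by (auto simp: space_pair_measure)
  moreover have "emeasure (M \<Otimes>\<^sub>M M) ({..t} \<times> {..t}) = ennreal ((cdf M t)\<^sup>2)"
    by (subst emeasure_pair_measure_Times)
       (auto simp: emeasure_eq_measure cdf_def power2_eq_square ennreal_mult')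
  moreover have "?I = ennreal (integrated_df (cdf M) t)"
    unfolding integrated_df_cdf set_lebesgue_integral_def real_scaleR_def
    by (intro nn_integral_eq_integral integrable_const_bound[where B=1])
       (auto simp: cdf_nonneg cdf_bounded_prob split: split_indicator)
  ultimately have "ennreal ((cdf M t)\<^sup>2) = ennreal (integrated_df (cdf M) t + integrated_df (cdf M) t)"
    by (subst ennreal_plus) (simp_all add: integrated_df_cdf_nonneg)
  then show ?thesis
    by (subst (asm) ennreal_inj) (auto simp: integrated_df_cdf_nonneg)
qed

lemma
  assumes "n \<ge> 1"
  defines "N \<equiv> \<lambda>X n \<omega>. distr (uniform_count_measure {1..n}) borel (\<lambda>i. X i \<omega> :: real)"
  shows real_distribution_empirical: "real_distribution (N X n \<omega>)"
    and cdf_empirical: "cdf (N X n \<omega>) = empirical_cdf X n \<omega>"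
    and integrated_df_empirical_cdf: "integrated_df (empirical_cdf X n \<omega>) t =
        (1 / real n) * (\<Sum>j = 1..n. empirical_cdf X n \<omega> (X j \<omega>) * indicator {..t} (X j \<omega>))"
proof -
  have m: "(\<lambda>i. X i \<omega>) \<in> measurable (uniform_count_measure {1..n}) borel"
    by (auto simp: measurable_def space_uniform_count_measure sets_uniform_count_measure)
  have "prob_space (uniform_count_measure {1..n})"
    using assms by (intro prob_space_uniform_count_measure) auto
  then show 1: "real_distribution (N X n \<omega>)"
    unfolding N_def using m by (rule prob_space.real_distribution_distr)
  show 2: "cdf (N X n \<omega>) = empirical_cdf X n \<omega>"
  proof
    fix t
    have eq: "(\<lambda>i. X i \<omega>) -` {..t} \<inter> {1..n} = {i \<in> {1..n}. X i \<omega> \<le> t}"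
      by auto
    have "cdf (N X n \<omega>) t = measure (uniform_count_measure {1..n}) {i \<in> {1..n}. X i \<omega> \<le> t}"
      unfolding N_def cdf_def
      by (subst measure_distr[OF m]) (simp_all only: space_uniform_count_measure eq atMost_borel)
    also have "\<dots> = real (card {i \<in> {1..n}. X i \<omega> \<le> t}) / real n"
      by (subst measure_uniform_count_measure) auto
    also have "real (card {i \<in> {1..n}. X i \<omega> \<le> t}) = (\<Sum>i = 1..n. indicator {..t} (X i \<omega>))"
      by (simp add: indicator_def sum.If_cases Int_def)
    finally show "cdf (N X n \<omega>) t = empirical_cdf X n \<omega> t"
      by (simp add: empirical_cdf_def)
  qed
  interpret real_distribution "N X n \<omega>" by fact
  have "integrated_df (empirical_cdf X n \<omega>) t = (LINT s:{..t}|N X n \<omega>. empirical_cdf X n \<omega> s)"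
    using integrated_df_cdf by (simp add: 2)
  also have "\<dots> = (LINT i|uniform_count_measure {1..n}.
      indicator {..t} (X i \<omega>) * empirical_cdf X n \<omega> (X i \<omega>))"
    unfolding N_def set_lebesgue_integral_def real_scaleR_def using m cdf_borel
    by (subst integral_distr) (auto simp: 2)
  also have "\<dots> = (1 / real n) * (\<Sum>j = 1..n. empirical_cdf X n \<omega> (X j \<omega>) * indicator {..t} (X j \<omega>))"
    by (simp add: integral_uniform_count_measure mult.commute)
  finally show "integrated_df (empirical_cdf X n \<omega>) t = \<dots>" .
qed

lemma bdd_above_integrated_emp_process:
  assumes "n \<ge> 1" "real_distribution N"
  shows "bdd_above (range (\<lambda>t. \<bar>integrated_emp_process X (cdf N) n \<omega> t\<bar>))"
proof (rule bdd_aboveI2)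
  fix t
  let ?E = "distr (uniform_count_measure {1..n}) borel (\<lambda>i. X i \<omega>)"
  have "\<bar>integrated_df (cdf ?E) t - integrated_df (cdf N) t\<bar> \<le> 1"
    using real_distribution.integrated_df_cdf_nonneg[OF assms(2), of t]
      real_distribution.integrated_df_cdf_le_1[OF assms(2), of t]
      real_distribution.integrated_df_cdf_nonneg[OF real_distribution_empirical[OF assms(1)], of X \<omega> t]
      real_distribution.integrated_df_cdf_le_1[OF real_distribution_empirical[OF assms(1)], of X \<omega> t]
    by linarith
  then show "\<bar>integrated_emp_process X (cdf N) n \<omega> t\<bar> \<le> sqrt (real n)"
    unfolding integrated_emp_process_def cdf_empirical[OF assms(1)]
    by (simp add: abs_mult mult_left_le)
qed

end

theory Submission
  imports Defs "HOL-Real_Asymp.Real_Asymp"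
begin

text \<open>
  Almost surely there are no ties, and then the integrated empirical distribution function at \<open>t\<close> is
  \<open>(N\<^sup>2 + N) / (2 n\<^sup>2)\<close>, where \<open>N\<close> is the number of observations up to \<open>t\<close>. So the process is
  \<open>F \<alpha>\<^sub>n\<close>, with \<open>\<alpha>\<^sub>n\<close> the ordinary empirical process, up to a uniform \<open>o(sqrt (ln (ln n)))\<close>. By the law
  of the iterated logarithm for indicators, \<open>F \<alpha>\<^sub>n\<close> has upper growth rate \<open>u sqrt (2 u (1 - u))\<close> at each
  point with \<open>F(t) = u\<close>, and this weight is largest at \<open>u = 3 / 4\<close>. The supremum over \<open>t\<close> reduces to a finite
  grid because a chaining argument along dyadic levels of \<open>F\<close>, based on a maximal exponential
  inequality, makes the oscillation of \<open>\<alpha>\<^sub>n\<close> between grid points a small multiple of \<open>sqrt (ln (ln n))\<close>.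
\<close>

section \<open>Maximal exponential inequality\<close>

text \<open>All almost sure arguments run along geometric times: near \<open>n = q ^ k\<close> the
  norming \<open>ln (ln n)\<close> is about \<open>ln k\<close>, so tail probabilities at a multiple
  of the critical level are powers of \<open>k\<close>, and Borel-Cantelli only asks whether the
  exponent exceeds 1. Hence the leading constant of the tail matters. From above it comes from a
  Chernoff bound whose correction vanishes because the levels are small against the variance. From
  below the obstacle is that the central limit theorem handles a fixed number of standard
  deviations, while a level growing like \<open>sqrt (ln k)\<close> is needed. The law at one point
  has an exceptional set and a starting time depending on that point, so it serves only finitely
  many points at once; the chaining has to be uniform in \<open>n\<close> and in the location. In
  \<open>N = n F + dev\<close> the square contributes \<open>dev^2\<close>, of order
  \<open>n ln (ln n)\<close>, which dies after division by \<open>n sqrt n\<close>; the cross term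
  carries the weight \<open>F\<close>. The squared growth rate is \<open>2 u^3 (1 - u)\<close>,
  stationary at \<open>u = 3 / 4\<close>.\<close>

lemma exp_le_quadratic:
  fixes y l :: real
  assumes "\<bar>y\<bar> \<le> 1" "0 \<le> l" "l \<le> 1"
  shows "exp (l * y) \<le> 1 + l * y + l\<^sup>2 * (1 + l) / 2 * y\<^sup>2"
proof -
  define x where "x = l * y"
  have x: "\<bar>x\<bar> \<le> l" "\<bar>x\<bar> \<le> 1"
    using assms mult_left_le[of "\<bar>y\<bar>" l] by (auto simp: x_def abs_mult)
  obtain t where t: "\<bar>t\<bar> \<le> \<bar>x\<bar>" and e: "exp x = (\<Sum>m<3. x ^ m / fact m) + exp t / fact 3 * x ^ 3"
    using Maclaurin_exp_le[of x 3] by blast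
  \<comment> \<open>The Lagrange remainder \<open>exp t / 6 * x ^ 3\<close> costs only a relative
    factor \<open>l\<close>: since \<open>exp t \<le> 3\<close> and
    \<open>x ^ 3 \<le> l * x\<^sup>2\<close>, it is at most half of
    \<open>l * x\<^sup>2\<close>.\<close>
  have "exp t \<le> exp 1" using t x by simp
  then have "exp t \<le> 3" using e_less_272 by linarith
  moreover have "x ^ 3 \<le> l * x\<^sup>2"
    using mult_right_mono[of x l "x\<^sup>2"] x by (auto simp: power3_eq_cube power2_eq_square mult.assoc)
  moreover have "0 \<le> l * x\<^sup>2" using assms by simp
  ultimately have "exp t * x ^ 3 \<le> 3 * (l * x\<^sup>2)"
    by (meson exp_ge_zero mult_mono order_trans mult_left_mono mult_right_mono)
  then have "exp x \<le> 1 + x + x\<^sup>2 / 2 + l * x\<^sup>2 / 2"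
    unfolding e by (simp add: eval_nat_numeral fact_numeral mult_ac)
  then show ?thesis
    by (simp add: x_def power2_eq_square algebra_simps add_divide_distrib)
qed

locale bounded_iid = prob_space +
  fixes Z :: "nat \<Rightarrow> 'a \<Rightarrow> real" and v :: real
  assumes indep: "indep_vars (\<lambda>_. borel) Z UNIV"
    and bounded: "\<bar>Z n \<omega>\<bar> \<le> 1"
    and mean: "expectation (Z n) = 0"
    and second_moment: "expectation (\<lambda>\<omega>. (Z n \<omega>)\<^sup>2) = v"
    and distr_eq: "distr M borel (Z n) = distr M borel (Z 0)"
begin

definition S :: "nat \<Rightarrow> 'a \<Rightarrow> real" where
  "S n \<omega> = (\<Sum>l<n. Z l \<omega>)"

lemma Z_measurable [measurable]: "Z n \<in> borel_measurable M"
  using indep by (auto simp: indep_vars_def)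

lemma S_measurable [measurable]: "S n \<in> borel_measurable M"
  unfolding S_def[abs_def] by measurable

lemma integrable_Z: "integrable M (Z n)" "integrable M (\<lambda>\<omega>. (Z n \<omega>)\<^sup>2)"
  using bounded by (auto intro!: integrable_const_bound[where B=1] simp: abs_square_le_1)

lemma v_nonneg: "0 \<le> v"
  by (subst second_moment[of 0, symmetric]) simp

lemma S_bounded: "\<bar>S n \<omega>\<bar> \<le> real n"
  unfolding S_def using sum_mono[of "{..<n}" "\<lambda>l. \<bar>Z l \<omega>\<bar>" "\<lambda>_. 1"] bounded
  by (intro order_trans[OF sum_abs]) auto

lemma uminus_bounded_iid: "bounded_iid M (\<lambda>n \<omega>. - Z n \<omega>) v"
proof unfold_locales
  show "indep_vars (\<lambda>_. borel) (\<lambda>n \<omega>. - Z n \<omega>) UNIV"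
    using indep_vars_compose2[OF indep, of "\<lambda>_ x. - x" "\<lambda>_. borel"] by simp
  show "distr M borel (\<lambda>\<omega>. - Z n \<omega>) = distr M borel (\<lambda>\<omega>. - Z 0 \<omega>)" for n
    using distr_distr[of uminus borel borel "Z n" M] distr_distr[of uminus borel borel "Z 0" M]
    by (simp add: distr_eq[of n] comp_def)
qed (use bounded mean second_moment in auto)

lemma integrable_exp_Z: "integrable M (\<lambda>\<omega>. exp (l * Z n \<omega>))"
proof (rule integrable_const_bound[where B="exp \<bar>l\<bar>"])
  have "\<bar>l * Z n \<omega>\<bar> \<le> \<bar>l\<bar> * 1" for \<omega>
    unfolding abs_mult by (intro mult_left_mono bounded) simp
  then have "l * Z n \<omega> \<le> \<bar>l\<bar>" for \<omega>
    using abs_ge_self[of "l * Z n \<omega>"] by (metis mult_1_right order_trans)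
  then show "AE \<omega> in M. norm (exp (l * Z n \<omega>)) \<le> exp \<bar>l\<bar>" by simp
qed measurable

lemma expectation_exp_le:
  assumes "0 \<le> l" "l \<le> 1"
  shows "expectation (\<lambda>\<omega>. exp (l * Z n \<omega>)) \<le> exp (v * (l\<^sup>2 * (1 + l) / 2))"
proof -
  have "expectation (\<lambda>\<omega>. exp (l * Z n \<omega>)) \<le>
      expectation (\<lambda>\<omega>. 1 + l * Z n \<omega> + l\<^sup>2 * (1 + l) / 2 * (Z n \<omega>)\<^sup>2)"
  proof (intro integral_mono)
    show "exp (l * Z n \<omega>) \<le> 1 + l * Z n \<omega> + l\<^sup>2 * (1 + l) / 2 * (Z n \<omega>)\<^sup>2" for \<omega>
      by (rule exp_le_quadratic[OF bounded assms])
  qed (use integrable_Z integrable_exp_Z in auto)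
  also have "\<dots> = 1 + v * (l\<^sup>2 * (1 + l) / 2)"
    using integrable_Z by (simp add: mean second_moment prob_space)
  also have "\<dots> \<le> exp (v * (l\<^sup>2 * (1 + l) / 2))"
    by (rule exp_ge_add_one_self)
  finally show ?thesis .
qed

lemma expectation_exp_ge_1: "1 \<le> expectation (\<lambda>\<omega>. exp (l * Z n \<omega>))"
proof -
  have "expectation (\<lambda>\<omega>. 1 + l * Z n \<omega>) \<le> expectation (\<lambda>\<omega>. exp (l * Z n \<omega>))"
    by (intro integral_mono integrable_exp_Z exp_ge_add_one_self) (simp add: integrable_Z)
  then show ?thesis using integrable_Z by (simp add: mean prob_space)
qed

definition passed :: "real \<Rightarrow> nat \<Rightarrow> 'a set" where
  "passed x n = {\<omega> \<in> space M. \<exists>m\<le>n. x \<le> S m \<omega>}"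

lemma passed_measurable [measurable]: "passed x n \<in> events"
  unfolding passed_def Bex_def[symmetric] atMost_iff[symmetric]
  by (intro sets.sets_Collect_finite_Ex borel_measurable_le) auto

lemma integrable_exp_S: "integrable M (\<lambda>\<omega>. exp (l * S n \<omega>) * indicator A \<omega>)" if [measurable]: "A \<in> events"
proof (rule integrable_const_bound[where B="exp (\<bar>l\<bar> * real n)"])
  have "\<bar>l * S n \<omega>\<bar> \<le> \<bar>l\<bar> * real n" for \<omega>
    unfolding abs_mult by (intro mult_left_mono S_bounded) simp
  then have "l * S n \<omega> \<le> \<bar>l\<bar> * real n" for \<omega>
    by (rule order_trans[OF abs_ge_self])
  then show "AE \<omega> in M. norm (exp (l * S n \<omega>) * indicator A \<omega>) \<le> exp (\<bar>l\<bar> * real n)"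
    by (auto split: split_indicator)
qed measurable

text \<open>
  Having passed the level \<open>x\<close> by time \<open>n\<close> is determined by the first \<open>n\<close> variables, hence
  independent of the next one.
\<close>

lemma expectation_exp_passed_Suc:
  "expectation (\<lambda>\<omega>. exp (l * S (Suc n) \<omega>) * indicator (passed x n) \<omega>) =
   expectation (\<lambda>\<omega>. exp (l * S n \<omega>) * indicator (passed x n) \<omega>) * expectation (\<lambda>\<omega>. exp (l * Z n \<omega>))"
proof -
  let ?P = "\<lambda>f. \<exists>m\<le>n. x \<le> (\<Sum>i<m. f i)"
  let ?Y1 = "\<lambda>f. exp (l * (\<Sum>i<n. f i)) * (if ?P f then 1 else 0 :: real)"
  let ?Y2 = "\<lambda>f. exp (l * f n)"
  have Y1: "?Y1 \<in> borel_measurable (PiM {..<n} (\<lambda>_. borel))"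
  proof -
    have [measurable]: "(\<lambda>f. \<Sum>i<m. f i) \<in> borel_measurable (PiM {..<n} (\<lambda>_. borel :: real measure))" if "m \<le> n" for m
      using that by (intro borel_measurable_sum measurable_component_singleton) auto
    have [measurable]: "Measurable.pred (PiM {..<n} (\<lambda>_. borel :: real measure)) ?P"
      unfolding pred_def Bex_def[symmetric] atMost_iff[symmetric]
      by (intro sets.sets_Collect_finite_Ex borel_measurable_le) auto
    show ?thesis by measurable
  qed
  have Y2: "?Y2 \<in> borel_measurable (PiM {n} (\<lambda>_. borel))"
    by measurable
  have eq: "(\<Sum>i<m. restrict (\<lambda>i. Z i \<omega>) {..<n} i) = S m \<omega>" if "m \<le> n" for m \<omega>
    using that by (auto simp: S_def intro!: sum.cong)
  have c: "?Y1 (restrict (\<lambda>i. Z i \<omega>) {..<n}) = exp (l * S n \<omega>) * (if \<exists>m\<le>n. x \<le> S m \<omega> then 1 else 0)" for \<omega>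
    by (simp only: eq order_refl cong: conj_cong)
  have "indep_var borel (?Y1 \<circ> (\<lambda>\<omega>. restrict (\<lambda>i. Z i \<omega>) {..<n}))
      borel (?Y2 \<circ> (\<lambda>\<omega>. restrict (\<lambda>i. Z i \<omega>) {n}))"
    by (rule indep_var_compose[OF indep_var_restrict[OF indep] Y1 Y2]) auto
  also have "(?Y1 \<circ> (\<lambda>\<omega>. restrict (\<lambda>i. Z i \<omega>) {..<n})) =
      (\<lambda>\<omega>. exp (l * S n \<omega>) * (if \<exists>m\<le>n. x \<le> S m \<omega> then 1 else 0))"
    unfolding comp_def c ..
  also have "(?Y2 \<circ> (\<lambda>\<omega>. restrict (\<lambda>i. Z i \<omega>) {n})) = (\<lambda>\<omega>. exp (l * Z n \<omega>))"
    by (simp add: comp_def)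
  finally have iv: "indep_var borel (\<lambda>\<omega>. exp (l * S n \<omega>) * (if \<exists>m\<le>n. x \<le> S m \<omega> then 1 else 0))
      borel (\<lambda>\<omega>. exp (l * Z n \<omega>))" .
  have int: "integrable M (\<lambda>\<omega>. exp (l * S n \<omega>) * (if \<exists>m\<le>n. x \<le> S m \<omega> then 1 else 0))"
    by (subst Bochner_Integration.integrable_cong[OF refl, where g="\<lambda>\<omega>. exp (l * S n \<omega>) * indicator (passed x n) \<omega>"])
       (auto simp: integrable_exp_S passed_def)
  have "expectation (\<lambda>\<omega>. exp (l * S (Suc n) \<omega>) * indicator (passed x n) \<omega>) =
     expectation (\<lambda>\<omega>. exp (l * S n \<omega>) * (if \<exists>m\<le>n. x \<le> S m \<omega> then 1 else 0) * exp (l * Z n \<omega>))"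
    by (rule Bochner_Integration.integral_cong) (auto simp: passed_def S_def algebra_simps exp_add)
  also have "\<dots> = expectation (\<lambda>\<omega>. exp (l * S n \<omega>) * (if \<exists>m\<le>n. x \<le> S m \<omega> then 1 else 0)) *
      expectation (\<lambda>\<omega>. exp (l * Z n \<omega>))"
    by (rule indep_var_lebesgue_integral[OF iv int integrable_exp_Z])
  also have "expectation (\<lambda>\<omega>. exp (l * S n \<omega>) * (if \<exists>m\<le>n. x \<le> S m \<omega> then 1 else 0)) =
     expectation (\<lambda>\<omega>. exp (l * S n \<omega>) * indicator (passed x n) \<omega>)"
    by (rule Bochner_Integration.integral_cong) (auto simp: passed_def)
  finally show ?thesis .
qed

lemma exp_mult_prob_le_expectation:
  assumes [measurable]: "A \<in> events" and "0 \<le> l" and A: "\<And>\<omega>. \<omega> \<in> A \<Longrightarrow> x \<le> S n \<omega>"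
  shows "exp (l * x) * prob A \<le> expectation (\<lambda>\<omega>. exp (l * S n \<omega>) * indicator A \<omega>)"
proof -
  have "exp (l * x) * prob A = expectation (\<lambda>\<omega>. exp (l * x) * indicator A \<omega>)"
    by simp
  also have "\<dots> \<le> expectation (\<lambda>\<omega>. exp (l * S n \<omega>) * indicator A \<omega>)"
  proof (rule integral_mono)
    show "integrable M (\<lambda>\<omega>. exp (l * x) * indicator A \<omega>)"
      by (rule integrable_const_bound[where B="exp (l * x)"]) (auto split: split_indicator)
    show "exp (l * x) * indicator A \<omega> \<le> exp (l * S n \<omega>) * indicator A \<omega>" for \<omega>
      using mult_left_mono[OF A \<open>0 \<le> l\<close>, of \<omega>] by (auto split: split_indicator)
  qed (rule integrable_exp_S[OF assms(1)])
  finally show ?thesis .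
qed

text \<open>Doob's maximal inequality for the submartingale \<open>exp (l * S n)\<close>, by
  induction on time. On paths that have already passed the level, the next factor is independent
  with mean at least 1, so the expectation cannot drop; paths passing just now are covered by
  Markov's inequality at the current time.\<close>

lemma passed_le_expectation:
  assumes "0 \<le> l"
  shows "exp (l * x) * prob (passed x n) \<le> expectation (\<lambda>\<omega>. exp (l * S n \<omega>) * indicator (passed x n) \<omega>)"
proof (induction n)
  case 0
  show ?case
    by (rule exp_mult_prob_le_expectation[OF passed_measurable assms]) (simp add: passed_def)
next
  case (Suc n)
  let ?I = "\<lambda>A. \<lambda>\<omega>. exp (l * S (Suc n) \<omega>) * indicator A \<omega>"
  let ?D = "passed x (Suc n) - passed x n"
  have sub: "passed x n \<subseteq> passed x (Suc n)" by (auto simp: passed_def intro: le_SucI)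
  have "exp (l * x) * prob (passed x (Suc n)) = exp (l * x) * prob (passed x n) + exp (l * x) * prob ?D"
    using finite_measure_Diff[of "passed x (Suc n)" "passed x n"] sub by (simp add: distrib_left[symmetric])
  also have "exp (l * x) * prob (passed x n) \<le> expectation (?I (passed x n))"
  proof -
    have "expectation (\<lambda>\<omega>. exp (l * S n \<omega>) * indicator (passed x n) \<omega>) * 1 \<le> expectation (?I (passed x n))"
      unfolding expectation_exp_passed_Suc
      by (intro mult_left_mono expectation_exp_ge_1 Bochner_Integration.integral_nonneg) auto
    with Suc show ?thesis by simp
  qed
  also have "exp (l * x) * prob ?D \<le> expectation (?I ?D)"
    by (rule exp_mult_prob_le_expectation[OF _ assms]) (auto simp: passed_def le_Suc_eq)
  also have "expectation (?I (passed x n)) + expectation (?I ?D) =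
      expectation (\<lambda>\<omega>. ?I (passed x n) \<omega> + ?I ?D \<omega>)"
    by (intro Bochner_Integration.integral_add[symmetric] integrable_exp_S) auto
  also have "\<dots> = expectation (?I (passed x (Suc n)))"
    using sub by (intro Bochner_Integration.integral_cong) (auto split: split_indicator)
  finally show ?case by simp
qed

lemma expectation_exp_S:
  assumes "0 \<le> l" "l \<le> 1"
  shows "expectation (\<lambda>\<omega>. exp (l * S n \<omega>)) \<le> exp (real n * v * (l\<^sup>2 * (1 + l) / 2))"
proof -
  have "expectation (\<lambda>\<omega>. exp (l * S n \<omega>)) = expectation (\<lambda>\<omega>. \<Prod>i<n. exp (l * Z i \<omega>))"
    by (simp add: S_def sum_distrib_left exp_sum)
  also have "\<dots> = (\<Prod>i<n. expectation (\<lambda>\<omega>. exp (l * Z i \<omega>)))"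
    using indep_vars_compose2[OF indep_vars_subset[OF indep], of "{..<n}" "\<lambda>_ x. exp (l * x)" "\<lambda>_. borel"]
    by (intro indep_vars_lebesgue_integral integrable_exp_Z) auto
  also have "\<dots> \<le> (\<Prod>i<n. exp (v * (l\<^sup>2 * (1 + l) / 2)))"
    by (intro prod_mono conjI expectation_exp_le assms Bochner_Integration.integral_nonneg) auto
  finally show ?thesis by (simp add: exp_of_nat_mult[symmetric] mult.assoc)
qed

lemma maximal_upper:
  assumes V: "real N * v \<le> V" "0 < x" "x \<le> V"
  shows "prob (passed x N) \<le> exp (- (x\<^sup>2 / (2 * V) * (1 - x / V)))"
proof -
  \<comment> \<open>This \<open>l\<close> minimises the Gaussian exponent
    \<open>V * l\<^sup>2 / 2 - l * x\<close>. The cubic correction then turns up as the factor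
    \<open>1 - x / V\<close>, and \<open>x \<le> V\<close> keeps \<open>l \<le> 1\<close>.\<close>
  define l where "l = x / V"
  have l: "0 \<le> l" "l \<le> 1" "V * l = x" "0 < V"
    using V by (auto simp: l_def)
  have "exp (l * x) * prob (passed x N) \<le> expectation (\<lambda>\<omega>. exp (l * S N \<omega>) * indicator (passed x N) \<omega>)"
    by (rule passed_le_expectation) (use l in auto)
  also have "\<dots> \<le> expectation (\<lambda>\<omega>. exp (l * S N \<omega>))"
  proof (rule integral_mono[OF integrable_exp_S])
    have "integrable M (\<lambda>\<omega>. exp (l * S N \<omega>) * indicator (space M) \<omega>)"
      by (rule integrable_exp_S) simp
    also have "?this \<longleftrightarrow> integrable M (\<lambda>\<omega>. exp (l * S N \<omega>))"
      by (rule Bochner_Integration.integrable_cong) auto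
    finally show "integrable M (\<lambda>\<omega>. exp (l * S N \<omega>))" .
  qed (auto split: split_indicator)
  also have "\<dots> \<le> exp (real N * v * (l\<^sup>2 * (1 + l) / 2))"
    by (rule expectation_exp_S) (use l in auto)
  also have "\<dots> \<le> exp (V * (l\<^sup>2 * (1 + l) / 2))"
    using V l by (auto intro!: mult_right_mono)
  finally have "prob (passed x N) \<le> exp (V * (l\<^sup>2 * (1 + l) / 2)) / exp (l * x)"
    by (simp add: field_simps)
  also have "\<dots> = exp (V * (l\<^sup>2 * (1 + l) / 2) - l * x)"
    by (simp add: exp_diff)
  also have "V * (l\<^sup>2 * (1 + l) / 2) - l * x = - (x\<^sup>2 / (2 * V) * (1 - x / V))"
    using l(4) by (simp add: l_def field_simps power2_eq_square)
  finally show ?thesis .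
qed

lemma maximal_abs:
  assumes V: "real N * v \<le> V" "0 < x" "x \<le> V"
  shows "prob {\<omega> \<in> space M. \<exists>n\<le>N. x \<le> \<bar>S n \<omega>\<bar>} \<le> 2 * exp (- (x\<^sup>2 / (2 * V) * (1 - x / V)))"
proof -
  interpret m: bounded_iid M "\<lambda>n \<omega>. - Z n \<omega>" v by (rule uminus_bounded_iid)
  have S: "m.S n \<omega> = - S n \<omega>" for n \<omega>
    by (simp add: m.S_def S_def sum_negf)
  have "{\<omega> \<in> space M. \<exists>n\<le>N. x \<le> \<bar>S n \<omega>\<bar>} = passed x N \<union> m.passed x N"
    by (auto simp: passed_def m.passed_def S abs_if split: if_splits)
  then have "prob {\<omega> \<in> space M. \<exists>n\<le>N. x \<le> \<bar>S n \<omega>\<bar>} \<le> prob (passed x N) + prob (m.passed x N)"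
    by (simp add: measure_Un_le)
  with maximal_upper[OF assms] m.maximal_upper[OF assms] show ?thesis by linarith
qed


section \<open>Law of the iterated logarithm for bounded variables\<close>

text \<open>At time \<theta>\<open>^ Suc k\<close> the level \<open>x k\<close> is exceeded with
  probability of order \<open>k powr (- (1 + d))\<close>, which is summable. The maximal inequality
  covers every \<open>n\<close> up to that time, so replacing the variance and the logarithm at the
  end of a block by those at \<open>n\<close> costs only factors \<open>1 + d\<close>.\<close>

lemma lil_upper:
  assumes "0 < v" "0 < e"
  shows "AE \<omega> in M. \<forall>\<^sub>F n in sequentially. \<bar>S n \<omega>\<bar> \<le> (1 + e) * sqrt (2 * v * real n * ln (ln (real n)))"
proof -
  \<comment> \<open>The losses amount to \<open>(1 + d)\<^sup>2\<close>, which for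
    \<open>d \<le> 1\<close> is at most \<open>1 + 3 * d\<close> and so at most
    \<open>1 + e\<close>.\<close>
  define d where "d = min 1 e / 3"
  have d: "0 < d" "d \<le> 1" and "3 * d \<le> e" using assms by (auto simp: d_def)
  define \<theta> where "\<theta> = 1 + d"
  have \<theta>: "1 < \<theta>" using d by (simp add: \<theta>_def)
  define V where "V k = \<theta> ^ Suc k * v" for k
  define x where "x k = (1 + d) * sqrt (2 * V k * ln (real k))" for k
  define N where "N k = nat \<lfloor>\<theta> ^ Suc k\<rfloor>" for k
  define A where "A k = {\<omega> \<in> space M. \<exists>n\<le>N k. x k \<le> \<bar>S n \<omega>\<bar>}" for k
  have V: "0 < V k" for k using \<theta> assms by (simp add: V_def)
  have NV: "real (N k) * v \<le> V k" for k
    unfolding V_def N_def using \<theta> assms by (intro mult_right_mono) auto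
  have lim: "(\<lambda>k. x k / V k) \<longlonglongrightarrow> 0"
    unfolding x_def V_def using \<theta> assms by real_asymp
  \<comment> \<open>The factor \<open>1 - x k / V k\<close> may use up one of the two factors
    \<open>1 + d\<close> in the exponent, because
    \<open>(1 + d)\<^sup>2 * (1 - d / (1 + d)) = 1 + d\<close>.\<close>
  have ev: "\<forall>\<^sub>F k in sequentially. x k / V k < d / (1 + d)"
    using order_tendstoD(2)[OF lim, of "d / (1 + d)"] d by simp
  have bound: "\<forall>\<^sub>F k in sequentially. prob (A k) \<le> 2 * real k powr (- (1 + d))"
    using ev eventually_ge_at_top[of 2]
  proof eventually_elim
    case (elim k)
    have lnk: "0 < ln (real k)" using elim by simp
    have xk: "0 < x k" unfolding x_def using d V[of k] lnk by simp
    have "d / (1 + d) \<le> 1" using d by simp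
    then have "x k / V k \<le> 1" using elim by linarith
    then have "x k \<le> V k" using V[of k] by (simp add: pos_divide_le_eq)
    then have "prob (A k) \<le> 2 * exp (- ((x k)\<^sup>2 / (2 * V k) * (1 - x k / V k)))"
      unfolding A_def by (intro maximal_abs NV xk)
    also have "(x k)\<^sup>2 / (2 * V k) = (1 + d)\<^sup>2 * ln (real k)"
      using V[of k] lnk by (simp add: x_def power_mult_distrib)
    also have "2 * exp (- ((1 + d)\<^sup>2 * ln (real k) * (1 - x k / V k))) \<le> 2 * exp (- ((1 + d) * ln (real k)))"
    proof -
      have "1 + d = (1 + d)\<^sup>2 * (1 - d / (1 + d))"
        using d by (simp add: field_simps power2_eq_square)
      also have "\<dots> \<le> (1 + d)\<^sup>2 * (1 - x k / V k)"
        using elim by (intro mult_left_mono) auto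
      finally have "(1 + d) * ln (real k) \<le> (1 + d)\<^sup>2 * (1 - x k / V k) * ln (real k)"
        using lnk by (intro mult_right_mono) auto
      then show ?thesis by (simp add: mult_ac)
    qed
    also have "exp (- ((1 + d) * ln (real k))) = real k powr (- (1 + d))"
      using elim by (simp add: powr_def algebra_simps)
    finally show ?case .
  qed
  have meas: "A k \<in> events" for k
    unfolding A_def Bex_def[symmetric] atMost_iff[symmetric]
    by (intro sets.sets_Collect_finite_Ex borel_measurable_le) auto
  have "summable (\<lambda>k. 2 * real k powr (- (1 + d)))"
    using d by (intro summable_mult) (simp add: summable_real_powr_iff)
  then have "summable (\<lambda>k. prob (A k))"
    by (rule summable_comparison_test_ev[rotated]) (use bound in simp)
  then have "AE \<omega> in M. \<forall>\<^sub>F k in sequentially. \<omega> \<in> space M - A k"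
    by (intro borel_cantelli_AE1 meas) (simp_all add: emeasure_eq_measure)
  then show ?thesis
  proof (rule AE_mp, intro AE_I2 impI)
    fix \<omega> assume "\<omega> \<in> space M" and *: "\<forall>\<^sub>F k in sequentially. \<omega> \<in> space M - A k"
    define K where "K n = nat \<lfloor>log \<theta> (real n)\<rfloor>" for n :: nat
    have K: "filterlim K at_top sequentially"
      unfolding K_def using \<theta> by real_asymp
    \<comment> \<open>Changing the base of the inner logarithm adds the constant
      \<open>- ln (ln\<close> \<theta>\<open>)\<close> outside, which \<open>d * ln (ln n)\<close>
      eventually absorbs.\<close>
    have ln: "\<forall>\<^sub>F n in sequentially. ln (log \<theta> (real n)) \<le> (1 + d) * ln (ln (real n))"
      using \<theta> d by real_asymp
    show "\<forall>\<^sub>F n in sequentially. \<bar>S n \<omega>\<bar> \<le> (1 + e) * sqrt (2 * v * real n * ln (ln (real n)))"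
      using eventually_compose_filterlim[OF * K] eventually_compose_filterlim[OF eventually_ge_at_top[of 1] K] ln
        eventually_ge_at_top[of 3]
    proof eventually_elim
      case (elim n)
      let ?k = "K n"
      have n: "0 < real n" using elim by simp
      have l: "0 \<le> log \<theta> (real n)" using elim \<theta> by (simp add: zero_le_log_cancel_iff)
      have k: "real ?k \<le> log \<theta> (real n)" "log \<theta> (real n) < real ?k + 1"
        using l by (auto simp: K_def) 
      have k1: "\<theta> ^ ?k \<le> real n"
        using k(1) \<theta> n by (simp add: le_log_iff powr_realpow)
      have "real n < \<theta> powr (real ?k + 1)"
        using k(2) \<theta> n by (simp add: log_less_iff)
      also have "\<theta> powr (real ?k + 1) = \<theta> ^ Suc ?k"
        using \<theta> powr_realpow[of \<theta> "Suc ?k"] by (simp add: add.commute)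
      finally have "n \<le> N ?k" by (simp add: N_def le_nat_iff le_floor_iff)
      moreover have "\<not> (\<exists>n\<le>N ?k. x ?k \<le> \<bar>S n \<omega>\<bar>)"
        using elim(1) by (simp add: A_def)
      ultimately have "\<bar>S n \<omega>\<bar> < x ?k" by (meson not_le)
      also have "x ?k \<le> (1 + d) * sqrt ((1 + d)\<^sup>2 * (2 * v * real n * ln (ln (real n))))"
      proof -
        have "ln (real ?k) \<le> ln (log \<theta> (real n))"
          using k elim by (subst ln_le_cancel_iff) auto
        also note elim(3)
        finally have lk: "ln (real ?k) \<le> (1 + d) * ln (ln (real n))" .
        have "\<theta> ^ Suc ?k \<le> (1 + d) * real n"
          using k1 \<theta> d by (simp add: \<theta>_def)
        then have "V ?k \<le> (1 + d) * real n * v"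
          unfolding V_def using assms by (intro mult_right_mono) auto
        then have "V ?k * ln (real ?k) \<le> ((1 + d) * real n * v) * ((1 + d) * ln (ln (real n)))"
          using lk elim V[of ?k] d assms by (intro mult_mono) auto
        then show ?thesis
          unfolding x_def using d by (intro mult_left_mono) (auto simp: power2_eq_square mult_ac)
      qed
      also have "\<dots> = (1 + d)\<^sup>2 * sqrt (2 * v * real n * ln (ln (real n)))"
        using d by (simp add: real_sqrt_mult power2_eq_square)
      also have "\<dots> \<le> (1 + e) * sqrt (2 * v * real n * ln (ln (real n)))"
      proof (rule mult_right_mono)
        have "(1 + d)\<^sup>2 \<le> 1 + 3 * d"
          using d mult_left_le[of d d] by (simp add: power2_eq_square algebra_simps)
        then show "(1 + d)\<^sup>2 \<le> 1 + e" using \<open>3 * d \<le> e\<close> by simp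
        have "1 \<le> ln (real n)" using elim exp_le by (subst ln_ge_iff) auto
        then show "0 \<le> sqrt (2 * v * real n * ln (ln (real n)))"
          using assms by simp
      qed
      finally show ?case by simp
    qed
  qed
qed

end

section \<open>Lower half of the law of the iterated logarithm\<close>

text \<open>By independence and \<open>1 - p \<le> exp (- p)\<close>, missing \<open>L\<close>
  consecutive events has probability at most the exponential of minus the sum of their
  probabilities. If missing all of them from \<open>K\<close> on had positive probability, its
  logarithm would bound these sums.\<close>

lemma (in prob_space) borel_cantelli_indep_vars:
  fixes D :: "nat \<Rightarrow> 'a \<Rightarrow> real"
  assumes ind: "indep_vars (\<lambda>_. borel) D UNIV"
    and ns: "\<not> summable (\<lambda>k. prob {\<omega> \<in> space M. x k \<le> D k \<omega>})"
  shows "AE \<omega> in M. \<exists>\<^sub>F k in sequentially. x k \<le> D k \<omega>"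
proof -
  have D [measurable]: "D k \<in> borel_measurable M" for k
    using ind by (auto simp: indep_vars_def)
  define p where "p k = prob {\<omega> \<in> space M. x k \<le> D k \<omega>}" for k
  have p: "0 \<le> p k" for k by (simp add: p_def)
  have compl: "prob {\<omega> \<in> space M. D k \<omega> < x k} = 1 - p k" for k
  proof -
    have "{\<omega> \<in> space M. D k \<omega> < x k} = space M - {\<omega> \<in> space M. x k \<le> D k \<omega>}" by auto
    then show ?thesis unfolding p_def by (simp add: prob_compl)
  qed
  have "AE \<omega> in M. \<exists>k\<ge>K. x k \<le> D k \<omega>" for K
  proof -
    define N where "N = {\<omega> \<in> space M. \<forall>k\<ge>K. D k \<omega> < x k}"
    have N [measurable]: "N \<in> events"
      unfolding N_def by measurable
    have fin: "prob N \<le> exp (- (\<Sum>k<L. p (k + K)))" for L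
    proof (cases "L = 0")
      case False
      have "prob N \<le> prob (\<Inter>k\<in>{K..<K+L}. D k -` {..<x k} \<inter> space M)"
        using False by (intro finite_measure_mono sets.finite_INT) (auto simp: N_def)
      also have "\<dots> = (\<Prod>k\<in>{K..<K+L}. prob (D k -` {..<x k} \<inter> space M))"
        using False by (intro indep_varsD_finite[OF indep_vars_subset[OF ind]]) auto
      also have "\<dots> = (\<Prod>k\<in>{K..<K+L}. 1 - p k)"
        unfolding compl[symmetric] by (intro prod.cong refl arg_cong[where f=prob]) auto
      also have "\<dots> \<le> (\<Prod>k\<in>{K..<K+L}. exp (- p k))"
      proof (intro prod_mono conjI)
        show "0 \<le> 1 - p k" for k by (simp add: p_def)
        show "1 - p k \<le> exp (- p k)" for k using exp_ge_add_one_self[of "- p k"] by simp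
      qed
      also have "\<dots> = exp (- (\<Sum>k\<in>{K..<K+L}. p k))"
        by (simp add: exp_sum sum_negf[symmetric])
      also have "(\<Sum>k\<in>{K..<K+L}. p k) = (\<Sum>k<L. p (k + K))"
        using sum.shift_bounds_nat_ivl[of p 0 K L] by (simp add: add.commute atLeast0LessThan)
      finally show ?thesis .
    qed simp
    have "prob N = 0"
    proof (rule ccontr)
      assume "prob N \<noteq> 0"
      then have pos: "0 < prob N" by (simp add: zero_less_measure_iff)
      have sb: "(\<Sum>k<L. p (k + K)) \<le> - ln (prob N)" for L
        using fin[of L] pos ln_le_cancel_iff[of "prob N" "exp (- (\<Sum>k<L. p (k + K)))"] by simp
      have "summable (\<lambda>k. p (k + K))"
      proof (rule bounded_imp_summable)
        show "0 \<le> p (n + K)" "(\<Sum>k\<le>n. p (k + K)) \<le> - ln (prob N)" for n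
          using sb[of "Suc n"] p by (simp_all only: lessThan_Suc_atMost)
      qed
      then show False using ns by (subst (asm) summable_iff_shift) (simp add: p_def[abs_def])
    qed
    then have "AE \<omega> in M. \<omega> \<notin> N"
      by (intro AE_not_in) (simp add: null_sets_def emeasure_eq_measure)
    then show ?thesis by (rule AE_mp) (auto simp: N_def not_less intro!: AE_I2)
  qed
  then have "AE \<omega> in M. \<forall>K. \<exists>k\<ge>K. x k \<le> D k \<omega>"
    by (simp add: AE_all_countable)
  then show ?thesis by (simp add: frequently_sequentially)
qed

text \<open>The density on \<open>{y..y + 1}\<close> is at least its value at \<open>y + 1\<close>.
  Moving on to \<open>y + 2\<close> gains a factor of at least \<open>exp (3 / 2)\<close>, more than
  the normalising constant \<open>sqrt (2 * pi)\<close>. The strict inequality leaves room for the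
  weak limit in \<open>clt_tail\<close>.\<close>

lemma std_normal_tail:
  assumes "0 \<le> y"
  shows "exp (- ((y + 2)\<^sup>2 / 2)) < measure std_normal_distribution {y..}"
proof -
  interpret real_distribution std_normal_distribution
    by (rule real_dist_normal_dist)
  let ?c = "std_normal_density (y + 1)"
  have "ennreal ?c = (\<integral>\<^sup>+x. ennreal ?c * indicator {y..y+1} x \<partial>lborel)"
    by (simp add: nn_integral_cmult_indicator)
  also have "\<dots> \<le> (\<integral>\<^sup>+x. ennreal (std_normal_density x) * indicator {y..} x \<partial>lborel)"
  proof (intro nn_integral_mono)
    fix x :: real
    have "?c \<le> std_normal_density x" if "y \<le> x" "x \<le> y + 1"
      using that assms by (auto simp: std_normal_density_def intro!: divide_right_mono power_mono)
    then show "ennreal ?c * indicator {y..y+1} x \<le> ennreal (std_normal_density x) * indicator {y..} x"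
      by (auto split: split_indicator intro!: ennreal_leI)
  qed
  also have "\<dots> = emeasure std_normal_distribution {y..}"
    by (simp add: emeasure_density)
  finally have "?c \<le> measure std_normal_distribution {y..}"
    by (simp add: emeasure_eq_measure)
  moreover have "exp (- ((y + 2)\<^sup>2 / 2)) < ?c"
  proof -
    define b where "b = (y + 1)\<^sup>2 / 2"
    define c where "c = (y + 2)\<^sup>2 / 2"
    have "sqrt (2 * pi) < 3"
      using pi_less_4 by (intro real_less_lsqrt) auto
    also have "3 \<le> exp (3 / 2 :: real)"
      using exp_lower_Taylor_quadratic[of "3 / 2"] by (simp add: power2_eq_square)
    also have "\<dots> \<le> exp (c - b)"
      using assms by (simp add: b_def c_def power2_eq_square field_simps)
    finally have "sqrt (2 * pi) * exp b < exp c"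
      by (simp add: exp_diff field_simps)
    then have "exp (- c) < 1 / sqrt (2 * pi) * exp (- b)"
      by (simp add: exp_minus field_simps)
    then show ?thesis by (simp add: std_normal_density_def b_def c_def)
  qed
  ultimately show ?thesis by linarith
qed

context bounded_iid
begin

lemma indep_vars_block_sums:
  assumes "disjoint_family_on K L"
  shows "indep_vars (\<lambda>_. borel) (\<lambda>j \<omega>. \<Sum>l\<in>K j. Z l \<omega>) L"
proof -
  have "indep_vars (\<lambda>j. PiM (K j) (\<lambda>_. borel)) (\<lambda>j \<omega>. restrict (\<lambda>i. Z i \<omega>) (K j)) L"
    by (rule indep_vars_restrict[OF indep _ assms]) simp
  from indep_vars_compose2[OF this, of "\<lambda>j f. \<Sum>l\<in>K j. f l" "\<lambda>_. borel"]
  have "indep_vars (\<lambda>_. borel) (\<lambda>j \<omega>. \<Sum>l\<in>K j. restrict (\<lambda>i. Z i \<omega>) (K j) l) L"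
    by (simp add: borel_measurable_sum measurable_component_singleton)
  then show ?thesis by (simp cong: sum.cong)
qed

text \<open>Each further summand convolves with the same distribution, so only the number of
  summands counts. This carries the tail bound of \<open>clt_tail\<close>, which concerns initial
  segments, over to arbitrary blocks.\<close>

lemma distr_block_sum:
  assumes "finite A"
  shows "distr M borel (\<lambda>\<omega>. \<Sum>l\<in>A. Z l \<omega>) = distr M borel (S (card A))"
  using assms
proof (induction A)
  case empty
  then show ?case by (simp add: S_def[abs_def])
next
  case (insert a A)
  have conv: "distr M borel (\<lambda>\<omega>. Z i \<omega> + (\<Sum>l\<in>B. Z l \<omega>)) =
      convolution (distr M borel (Z 0)) (distr M borel (\<lambda>\<omega>. \<Sum>l\<in>B. Z l \<omega>))"
    if "finite B" "i \<notin> B" for i B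
    unfolding distr_eq[of i, symmetric]
    by (intro sum_indep_random_variable indep_vars_sum indep_vars_subset[OF indep] that) auto
  show ?case
    using insert conv[of A a] conv[of "{..<card A}" "card A"]
    by (simp add: S_def[abs_def] add.commute)
qed

lemma prob_block_sum:
  assumes "finite A"
  shows "prob {\<omega> \<in> space M. x \<le> (\<Sum>l\<in>A. Z l \<omega>)} = prob {\<omega> \<in> space M. x \<le> S (card A) \<omega>}"
proof -
  have "measure (distr M borel f) {x..} = prob {\<omega> \<in> space M. x \<le> f \<omega>}"
    if "f \<in> borel_measurable M" for f
    by (subst measure_distr) (auto simp: that intro!: arg_cong[where f=prob])
  from this[of "\<lambda>\<omega>. \<Sum>l\<in>A. Z l \<omega>"] this[of "S (card A)"] show ?thesis
    by (simp add: distr_block_sum[OF assms])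
qed

lemma clt_tail:
  assumes "0 < v" "0 \<le> y"
  shows "\<forall>\<^sub>F n in sequentially. exp (- ((y + 2)\<^sup>2 / 2)) \<le> prob {\<omega> \<in> space M. y * sqrt (real n * v) \<le> S n \<omega>}"
proof -
  let ?\<mu> = "\<lambda>n. distr M borel (\<lambda>\<omega>. (\<Sum>i<n. Z i \<omega>) / sqrt (real n * (sqrt v)\<^sup>2))"
  have conv: "weak_conv_m ?\<mu> std_normal_distribution"
    using assms integrable_Z mean second_moment distr_eq indep
    by (intro central_limit_theorem_zero_mean[where \<mu>="distr M borel (Z 0)"]) auto
  have "emeasure std_normal_distribution {y} = 0"
    using AE_lborel_singleton[of y]
    by (auto simp: emeasure_density nn_integral_0_iff_AE split: split_indicator elim!: AE_mp intro!: AE_I2)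
  moreover have "frontier {y..} = {y}"
    by (auto simp: frontier_def)
  ultimately have "(\<lambda>n. measure (?\<mu> n) {y..}) \<longlonglongrightarrow> measure std_normal_distribution {y..}"
    by (intro weak_conv_imp_continuity_set_conv[OF _ real_dist_normal_dist conv])
       (auto intro!: real_distribution_distr simp: measure_def)
  then have "\<forall>\<^sub>F n in sequentially. exp (- ((y + 2)\<^sup>2 / 2)) < measure (?\<mu> n) {y..}"
    by (rule order_tendstoD) (rule std_normal_tail[OF assms(2)])
  then show ?thesis
    using eventually_gt_at_top[of 0]
  proof eventually_elim
    case (elim n)
    have "measure (?\<mu> n) {y..} = prob {\<omega> \<in> space M. y * sqrt (real n * v) \<le> S n \<omega>}"
      using elim assms
      by (subst measure_distr) (auto simp: S_def pos_le_divide_eq intro!: arg_cong[where f=prob])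
    then show ?case using elim by simp
  qed
qed

lemma sum_blocks:
  fixes a r s :: nat and f :: "nat \<Rightarrow> real"
  shows "(\<Sum>l\<in>{a..<a + r * s}. f l) = (\<Sum>i<r. \<Sum>l\<in>{a + i * s..<a + i * s + s}. f l)"
proof (induction r)
  case (Suc r)
  have "(\<Sum>l\<in>{a..<a + Suc r * s}. f l) = (\<Sum>l\<in>{a..<a + r * s}. f l) + (\<Sum>l\<in>{a + r * s..<a + r * s + s}. f l)"
    by (subst sum.atLeastLessThan_concat) (auto simp: add_ac)
  then show ?case using Suc by simp
qed simp

text \<open>
  A block is split into \<open>r\<close> groups of equal length, whose sums are all required to be large. With
  \<open>r\<close> of order \<open>ln k\<close>, the central limit theorem for one group gives the sharp exponent of the tail.
\<close>

lemma prob_groups: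
  assumes "r * s \<le> m"
  shows "prob {\<omega> \<in> space M. x \<le> S s \<omega>} ^ r \<le>
    prob {\<omega> \<in> space M. real r * x - real (m - r * s) \<le> (\<Sum>l\<in>{a..<a + m}. Z l \<omega>)}"
proof -
  let ?G = "\<lambda>i. {a + i * s..<a + i * s + s}"
  let ?D = "\<lambda>i \<omega>. \<Sum>l\<in>?G i. Z l \<omega>"
  let ?E = "{\<omega> \<in> space M. \<forall>i<r. x \<le> ?D i \<omega>}"
  have E: "prob ?E = prob {\<omega> \<in> space M. x \<le> S s \<omega>} ^ r"
  proof (cases "r = 0")
    case False
    have "disjoint_family_on ?G {..<r}"
      unfolding disjoint_family_on_def
    proof (intro ballI impI)
      fix i j :: nat assume "i \<noteq> j"
      then have "Suc i \<le> j \<or> Suc j \<le> i" by auto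
      then have "Suc i * s \<le> j * s \<or> Suc j * s \<le> i * s" by (metis mult_le_mono1)
      then show "?G i \<inter> ?G j = {}" by auto
    qed
    then have ind: "indep_vars (\<lambda>_. borel) ?D {..<r}"
      by (rule indep_vars_block_sums)
    have "?E = (\<Inter>i\<in>{..<r}. ?D i -` {x..} \<inter> space M)"
      using False by auto
    also have "prob \<dots> = (\<Prod>i<r. prob (?D i -` {x..} \<inter> space M))"
      using False by (intro indep_varsD_finite[OF ind]) auto
    also have "\<dots> = (\<Prod>i<r. prob {\<omega> \<in> space M. x \<le> ?D i \<omega>})"
      by (intro prod.cong refl arg_cong[where f=prob]) auto
    also have "\<dots> = prob {\<omega> \<in> space M. x \<le> S s \<omega>} ^ r"
      by (subst prob_block_sum) auto
    finally show ?thesis .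
  qed (simp add: prob_space)
  have "prob ?E \<le> prob {\<omega> \<in> space M. real r * x - real (m - r * s) \<le> (\<Sum>l\<in>{a..<a + m}. Z l \<omega>)}"
  proof (rule finite_measure_mono)
    show "?E \<subseteq> {\<omega> \<in> space M. real r * x - real (m - r * s) \<le> (\<Sum>l\<in>{a..<a + m}. Z l \<omega>)}"
    proof (rule subsetI, rule CollectI, rule conjI)
      fix \<omega> assume \<omega>: "\<omega> \<in> ?E"
      then show "\<omega> \<in> space M" by simp
      from \<omega> have "\<forall>i<r. x \<le> ?D i \<omega>" by simp
      then have "real r * x \<le> (\<Sum>i<r. ?D i \<omega>)"
        using sum_mono[of "{..<r}" "\<lambda>_. x" "\<lambda>i. ?D i \<omega>"] by simp
      also have "\<dots> = (\<Sum>l\<in>{a..<a + r * s}. Z l \<omega>)"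
        by (rule sum_blocks[symmetric])
      finally have 1: "real r * x \<le> (\<Sum>l\<in>{a..<a + r * s}. Z l \<omega>)" .
      have "(\<Sum>l\<in>{a + r * s..<a + m}. - 1) \<le> (\<Sum>l\<in>{a + r * s..<a + m}. Z l \<omega>)"
        using bounded by (intro sum_mono) (metis abs_le_D2 minus_le_iff)
      then have "- real (m - r * s) \<le> (\<Sum>l\<in>{a + r * s..<a + m}. Z l \<omega>)"
        by simp
      moreover have "(\<Sum>l\<in>{a..<a + m}. Z l \<omega>) =
          (\<Sum>l\<in>{a..<a + r * s}. Z l \<omega>) + (\<Sum>l\<in>{a + r * s..<a + m}. Z l \<omega>)"
        using assms by (subst sum.atLeastLessThan_concat) auto
      ultimately show "real r * x - real (m - r * s) \<le> (\<Sum>l\<in>{a..<a + m}. Z l \<omega>)"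
        using 1 by linarith
    qed
  qed measurable
  then show ?thesis by (simp add: E)
qed

text \<open>With \<open>m\<close> the block length, take about
  \<open>r = 2 * ln k / B\<^sup>2\<close> groups, each exceeding \<open>y = B - 2\<close> standard
  deviations with probability at least \<open>exp (- B\<^sup>2 / 2)\<close>; together this gives at
  least \<open>1 / k\<close>. The groups add up to about \<open>y * sqrt (r * m * v)\<close>, which
  is \<open>1 - 2 / B\<close> times the critical level \<open>sqrt (2 * v * m * ln k)\<close>. The
  remaining \<open>1 / B\<close> pays for rounding \<open>r\<close> and for the variables outside
  the groups.\<close>

lemma prob_block_ge:
  assumes "0 < v" "3 < B" "2 \<le> q"
  shows "\<forall>\<^sub>F k in sequentially. 1 / real k \<le> prob {\<omega> \<in> space M.
      (1 - 3 / B) * sqrt (2 * v * (real q ^ k * (real q - 1)) * ln (real k)) \<le> (\<Sum>l\<in>{q ^ k..<q ^ Suc k}. Z l \<omega>)}"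
proof -
  \<comment> \<open>The shift by 2 pays for the loss in the Gaussian tail bound of \<open>clt_tail\<close>.\<close>
  define y where "y = B - 2"
  have y: "0 \<le> y" "y + 2 = B" using assms by (simp_all add: y_def)
  define m where "m k = q ^ k * (q - 1)" for k
  have m: "real (m k) = real q ^ k * (real q - 1)" for k
    using assms by (simp add: m_def of_nat_diff)
  define r where "r k = nat \<lfloor>2 * ln (real k) / B\<^sup>2\<rfloor>" for k
  obtain s0 where s0: "\<And>s. s0 \<le> s \<Longrightarrow> exp (- (B\<^sup>2 / 2)) \<le> prob {\<omega> \<in> space M. y * sqrt (real s * v) \<le> S s \<omega>}"
    using clt_tail[OF assms(1) y(1)] y(2) by (auto simp: eventually_sequentially)
  have q: "1 < real q" using assms by simp
  have e1: "\<forall>\<^sub>F k in sequentially. 1 \<le> 2 * ln (real k) / B\<^sup>2"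
    using assms by real_asymp
  have e2: "\<forall>\<^sub>F k in sequentially. real s0 * ln (real k) \<le> real q ^ k * (real q - 1)"
    using q by real_asymp
  have e3: "\<forall>\<^sub>F k in sequentially. (1 - 3 / B) * sqrt (2 * v * (real q ^ k * (real q - 1)) * ln (real k)) \<le>
      (B - 2) * sqrt ((2 * ln (real k) / B\<^sup>2 - 1) * (real q ^ k * (real q - 1) - ln (real k)) * v) - ln (real k)"
  proof -
    \<comment> \<open>Half of the spare \<open>1 / B\<close> goes into the two rounding errors under
      the root, which lower the coefficient from \<open>B - 2\<close> to
      \<open>(B - 2) * (1 - h) = B - 5 / 2\<close>. The other half covers the subtracted
      \<open>ln k\<close>, a bound for the sum of the leftover variables.\<close>
    define h where "h = 1 / (2 * (B - 2))"
    have h: "0 < h" "h < 1" "(B - 2) * (1 - h) = B - 5 / 2"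
      using assms by (simp_all add: h_def field_simps)
    have "\<forall>\<^sub>F k in sequentially. (1 - h) * (2 * ln (real k) / B\<^sup>2) \<le> 2 * ln (real k) / B\<^sup>2 - 1"
      using h assms by real_asymp
    moreover have "\<forall>\<^sub>F k in sequentially. ln (real k) \<le> h * (real q ^ k * (real q - 1))"
      using h q by real_asymp
    moreover have "\<forall>\<^sub>F k in sequentially. ln (real k) \<le> 1 / (2 * B) * sqrt (2 * v * (real q ^ k * (real q - 1)) * ln (real k))"
      using assms q by real_asymp
    ultimately show ?thesis
      using eventually_ge_at_top[of 2]
    proof eventually_elim
      case (elim k)
      define Q where "Q = real q ^ k * (real q - 1)"
      define u where "u = sqrt (2 * v * Q * ln (real k))"
      have Q: "0 < Q" using q by (simp add: Q_def)
      have lnk: "0 < ln (real k)" using elim by simp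
      have "((1 - h) * (2 * ln (real k) / B\<^sup>2)) * ((1 - h) * Q) * v \<le> (2 * ln (real k) / B\<^sup>2 - 1) * (Q - ln (real k)) * v"
      proof (intro mult_right_mono mult_mono elim(1))
        show "(1 - h) * Q \<le> Q - ln (real k)"
          using elim(2) unfolding Q_def[symmetric] by (simp add: algebra_simps)
        have "0 \<le> (1 - h) * (2 * ln (real k) / B\<^sup>2)" using h lnk by simp
        then show "0 \<le> 2 * ln (real k) / B\<^sup>2 - 1" using elim(1) by linarith
      qed (use h Q assms in auto)
      moreover have "sqrt (((1 - h) * (2 * ln (real k) / B\<^sup>2)) * ((1 - h) * Q) * v) = (1 - h) / B * u"
      proof (rule real_sqrt_unique)
        show "((1 - h) / B * u)\<^sup>2 = ((1 - h) * (2 * ln (real k) / B\<^sup>2)) * ((1 - h) * Q) * v"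
          using Q lnk assms by (simp add: u_def power_mult_distrib power_divide) (simp add: power2_eq_square field_simps)
      qed (use h assms Q lnk in \<open>auto simp: u_def\<close>)
      ultimately have "(1 - h) / B * u \<le> sqrt ((2 * ln (real k) / B\<^sup>2 - 1) * (Q - ln (real k)) * v)"
        by (metis real_sqrt_le_mono)
      then have "(B - 2) * ((1 - h) / B * u) \<le> (B - 2) * sqrt ((2 * ln (real k) / B\<^sup>2 - 1) * (Q - ln (real k)) * v)"
        using assms by (intro mult_left_mono) auto
      moreover have "(B - 2) * ((1 - h) / B * u) = (B - 5 / 2) / B * u"
        by (simp add: h(3)[symmetric])
      moreover have "(B - 5 / 2) / B * u - 1 / (2 * B) * u = (1 - 3 / B) * u"
        using assms by (simp add: field_simps)
      ultimately show ?case
        using elim(3) unfolding Q_def[symmetric] u_def[symmetric] by linarith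
    qed
  qed
  have e4: "\<forall>\<^sub>F k in sequentially. ln (real k) \<le> real q ^ k * (real q - 1)"
    using q by real_asymp
  show ?thesis
    using e1 e2 e3 e4 eventually_ge_at_top[of 2]
  proof eventually_elim
    case (elim k)
    have lnk: "0 < ln (real k)" using elim by simp
    have "2 * ln (real k) / B\<^sup>2 \<le> 2 * ln (real k) / 2"
      using assms lnk power_mono[of 3 B 2] by (intro divide_left_mono) auto
    then have r: "real (r k) \<le> 2 * ln (real k) / B\<^sup>2" "2 * ln (real k) / B\<^sup>2 - 1 < real (r k)" "1 \<le> r k" "real (r k) \<le> ln (real k)"
      using elim(1) unfolding r_def by linarith+
    define s where "s = m k div r k"
    have rs: "r k * s \<le> m k" by (simp add: s_def)
    have "m k - r k * s = m k mod r k" by (simp add: s_def minus_mult_div_eq_mod)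
    also have "\<dots> < r k" using r by (intro mod_less_divisor) auto
    finally have rem: "real (m k - r k * s) \<le> ln (real k)" using r by linarith
    have "real (s0 * r k) \<le> real s0 * ln (real k)"
      using r by (simp add: mult_left_mono)
    also have "\<dots> \<le> real (m k)" using elim(2) by (simp add: m)
    finally have "s0 \<le> s"
      using r unfolding s_def of_nat_le_iff by (simp add: less_eq_div_iff_mult_less_eq)
    have "1 / real k = exp (- ln (real k))"
      using elim by (simp add: exp_minus divide_inverse)
    also have "\<dots> \<le> exp (- (B\<^sup>2 / 2) * real (r k))"
      using r(1) assms by (simp add: field_simps)
    also have "\<dots> = exp (- (B\<^sup>2 / 2)) ^ r k"
      by (simp add: exp_of_nat_mult[symmetric] mult.commute)
    also have "\<dots> \<le> prob {\<omega> \<in> space M. y * sqrt (real s * v) \<le> S s \<omega>} ^ r k"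
      by (intro power_mono s0 \<open>s0 \<le> s\<close>) simp
    also have "\<dots> \<le> prob {\<omega> \<in> space M. real (r k) * (y * sqrt (real s * v)) - real (m k - r k * s) \<le>
        (\<Sum>l\<in>{q ^ k..<q ^ k + m k}. Z l \<omega>)}"
      by (rule prob_groups[OF rs])
    also have "\<dots> \<le> prob {\<omega> \<in> space M.
      (1 - 3 / B) * sqrt (2 * v * (real q ^ k * (real q - 1)) * ln (real k)) \<le> (\<Sum>l\<in>{q ^ k..<q ^ k + m k}. Z l \<omega>)}"
    proof -
      have "(2 * ln (real k) / B\<^sup>2 - 1) * (real q ^ k * (real q - 1) - ln (real k)) * v \<le>
          real (r k) * (real (r k) * real s) * v"
      proof (intro mult_right_mono mult_mono)
        show "real q ^ k * (real q - 1) - ln (real k) \<le> real (r k) * real s"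
          using rem rs by (simp add: m[symmetric] of_nat_diff)
      qed (use r elim assms in auto)
      then have "(B - 2) * sqrt ((2 * ln (real k) / B\<^sup>2 - 1) * (real q ^ k * (real q - 1) - ln (real k)) * v) \<le>
          y * sqrt (real (r k) * (real (r k) * real s) * v)"
        using y unfolding y_def by (intro mult_left_mono real_sqrt_le_mono) auto
      also have "real (r k) * (real (r k) * real s) * v = (real (r k))\<^sup>2 * (real s * v)"
        by (simp add: power2_eq_square)
      also have "sqrt \<dots> = real (r k) * sqrt (real s * v)"
        by (simp add: real_sqrt_mult)
      finally have "(1 - 3 / B) * sqrt (2 * v * (real q ^ k * (real q - 1)) * ln (real k)) \<le>
          real (r k) * (y * sqrt (real s * v)) - real (m k - r k * s)"
        using elim(3) rem by (simp add: mult_ac)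
      then show ?thesis
        by (intro finite_measure_mono) auto
    qed
    also have "q ^ k + m k = q ^ Suc k"
      using assms by (simp add: m_def diff_mult_distrib2)
    finally show ?case .
  qed
qed

text \<open>The increments over the blocks from \<open>q ^ k\<close> to \<open>q ^ Suc k\<close> are
  independent and infinitely often almost as large as the whole sum should be. For large
  \<open>q\<close> the past \<open>S (q ^ k)\<close> is negligible by
  \<open>lil_upper\<close>.\<close>

lemma lil_lower:
  assumes "0 < v" "0 < e" "e \<le> 1"
  shows "AE \<omega> in M. \<exists>\<^sub>F n in sequentially. (1 - e) * sqrt (2 * v * real n * ln (ln (real n))) \<le> S n \<omega>"
proof -
  \<comment> \<open>The loss \<open>e\<close> is spread over four quarters: the factor
    \<open>1 - 3 / B\<close>, the missing part of the block, the past sum, and the replacement of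
    \<open>ln k\<close> by \<open>ln (ln (q ^ Suc k))\<close>.\<close>
  define B where "B = 12 / e"
  have B: "3 < B" "3 / B = e / 4" using assms by (simp_all add: B_def field_simps)
  \<comment> \<open>The past is bounded by \<open>2 * sqrt (2 * v * q ^ k * L)\<close>, which is at
    most \<open>2 / sqrt q \<le> e / 4\<close> times the norming at \<open>q ^ Suc k\<close>. The
    same choice makes \<open>1 - 1 / q\<close> at least \<open>1 - e / 4\<close>.\<close>
  define q where "q = nat \<lceil>64 / e\<^sup>2\<rceil>"
  have "64 / e\<^sup>2 \<le> real q" by (simp add: q_def)
  moreover have "64 / 1 \<le> 64 / e\<^sup>2"
    using assms by (intro divide_left_mono) (auto simp: power_le_one)
  ultimately have q: "64 \<le> real q" "64 / e\<^sup>2 \<le> real q" by simp_all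
  then have q1: "1 < real q" "2 \<le> q" by simp_all
  define L where "L n = ln (ln (real n))" for n
  define D where "D k \<omega> = (\<Sum>l\<in>{q ^ k..<q ^ Suc k}. Z l \<omega>)" for k \<omega>
  define x where "x k = (1 - 3 / B) * sqrt (2 * v * (real q ^ k * (real q - 1)) * ln (real k))" for k
  have "disjoint_family_on (\<lambda>k. {q ^ k..<q ^ Suc k}) UNIV"
    unfolding disjoint_family_on_def
  proof (intro ballI impI)
    fix i j :: nat assume "i \<noteq> j"
    then have "Suc i \<le> j \<or> Suc j \<le> i" by auto
    then have "q ^ Suc i \<le> q ^ j \<or> q ^ Suc j \<le> q ^ i"
      using q1 by (metis One_nat_def Suc_1 Suc_leD power_increasing)
    then show "{q ^ i..<q ^ Suc i} \<inter> {q ^ j..<q ^ Suc j} = {}" by auto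
  qed
  then have ind: "indep_vars (\<lambda>_. borel) D UNIV"
    unfolding D_def[abs_def] by (rule indep_vars_block_sums)
  have "\<not> summable (\<lambda>k. prob {\<omega> \<in> space M. x k \<le> D k \<omega>})"
  proof
    assume "summable (\<lambda>k. prob {\<omega> \<in> space M. x k \<le> D k \<omega>})"
    then have "summable (\<lambda>k. 1 / real k)"
      by (rule summable_comparison_test_ev[rotated])
         (use prob_block_ge[OF assms(1) B(1) q1(2)] in \<open>simp add: x_def D_def\<close>)
    then show False
      using summable_real_powr_iff[of "-1"] not_summable_harmonic[where 'a=real] by (simp add: divide_inverse)
  qed
  from borel_cantelli_indep_vars[OF ind this] lil_upper[OF assms(1), of 1]
  have "AE \<omega> in M. (\<exists>\<^sub>F k in sequentially. x k \<le> D k \<omega>) \<and>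
      (\<forall>\<^sub>F n in sequentially. \<bar>S n \<omega>\<bar> \<le> 2 * sqrt (2 * v * real n * L n))"
    by (simp add: L_def)
  then show ?thesis
  proof (rule AE_mp, intro AE_I2 impI, elim conjE)
    fix \<omega>
    assume D: "\<exists>\<^sub>F k in sequentially. x k \<le> D k \<omega>"
      and up: "\<forall>\<^sub>F n in sequentially. \<bar>S n \<omega>\<bar> \<le> 2 * sqrt (2 * v * real n * L n)"
    have qlim: "filterlim (\<lambda>k. q ^ k) at_top sequentially"
      using q1 by (intro filterlim_subseq) (auto simp: strict_mono_def power_strict_increasing)
    \<comment> \<open>\<open>ln (ln (q ^ Suc k))\<close> equals
      \<open>ln (k + 1) + ln (ln q)\<close>, hence is asymptotic to \<open>ln k\<close>.\<close>
    have e1: "\<forall>\<^sub>F k in sequentially. sqrt (ln (ln (real q ^ Suc k))) \<le> (1 + e / 4) * sqrt (ln (real k))"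
      using q1(1) assms by real_asymp
    have e2: "\<forall>\<^sub>F k in sequentially. 3 \<le> q ^ k"
      using qlim by (simp add: filterlim_at_top)
    have imp: "\<forall>\<^sub>F k in sequentially. x k \<le> D k \<omega> \<longrightarrow>
        (1 - e) * sqrt (2 * v * real (q ^ Suc k) * L (q ^ Suc k)) \<le> S (q ^ Suc k) \<omega>"
      using eventually_compose_filterlim[OF up qlim] e1 e2 eventually_ge_at_top[of 2]
    proof eventually_elim
      case (elim k)
      show ?case
      proof
        assume xD: "x k \<le> D k \<omega>"
        define c where "c = sqrt (2 * v * real (q ^ Suc k))"
        define h where "h = sqrt (ln (real k))"
        define g where "g = sqrt (L (q ^ Suc k))"
        have c: "0 \<le> c" "0 \<le> h" using assms elim by (simp_all add: c_def h_def)
        have g: "g \<le> (1 + e / 4) * h" using elim by (simp add: g_def h_def L_def)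
        have L: "0 \<le> L (q ^ k)" "L (q ^ k) \<le> L (q ^ Suc k)"
        proof -
          have "3 \<le> real (q ^ k)" using elim(3) by (metis of_nat_le_iff of_nat_numeral)
          then have "1 \<le> ln (real (q ^ k))"
            using exp_le by (subst ln_ge_iff) linarith+
          moreover have "ln (real (q ^ k)) \<le> ln (real (q ^ Suc k))"
            using q1 by (subst ln_le_cancel_iff) auto
          ultimately show "0 \<le> L (q ^ k)" "L (q ^ k) \<le> L (q ^ Suc k)"
            unfolding L_def by (auto simp del: of_nat_power)
        qed
        then have g0: "0 \<le> g" by (simp add: g_def)
        have "(1 - e / 4) * ((1 - e / 4) * (c * h)) \<le> (1 - e / 4) * sqrt (2 * v * (real q ^ k * (real q - 1)) * ln (real k))"
        proof (rule mult_left_mono)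
          have "64 \<le> real q * e\<^sup>2" using q(2) assms by (simp add: field_simps)
          also have "\<dots> \<le> real q * e" using assms by (intro mult_left_mono) (simp_all add: power2_eq_square mult_left_le)
          finally have "real q * (1 - e / 4) \<le> real q - 1" by (simp add: algebra_simps)
          moreover have "(1 - e / 4)\<^sup>2 \<le> 1 - e / 4"
            using assms mult_left_le[of "1 - e / 4" "1 - e / 4"] by (simp add: power2_eq_square)
          ultimately have "real q * (1 - e / 4)\<^sup>2 \<le> real q - 1"
            using mult_left_mono[of "(1 - e / 4)\<^sup>2" "1 - e / 4" "real q"] by linarith
          then have "(real q ^ k * (real q * (1 - e / 4)\<^sup>2)) * (2 * v * ln (real k)) \<le> (real q ^ k * (real q - 1)) * (2 * v * ln (real k))"
            using assms elim by (intro mult_right_mono mult_left_mono) auto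
          moreover have "(1 - e / 4) * (c * h) = sqrt ((1 - e / 4)\<^sup>2 * (2 * v * real (q ^ Suc k)) * ln (real k))"
            using assms by (simp add: c_def h_def real_sqrt_mult)
          ultimately show "(1 - e / 4) * (c * h) \<le> sqrt (2 * v * (real q ^ k * (real q - 1)) * ln (real k))"
            by (simp add: mult_ac)
        qed (use assms in simp)
        also have "\<dots> \<le> D k \<omega>" using xD B by (simp add: x_def)
        finally have 1: "(1 - e / 4) * ((1 - e / 4) * (c * h)) \<le> D k \<omega>" .
        have 2: "2 * sqrt (2 * v * real (q ^ k) * L (q ^ k)) \<le> e / 4 * (c * g)"
        proof -
          have "64 * (2 * v * real (q ^ k) * L (q ^ k)) \<le> (real q * e\<^sup>2) * (2 * v * real (q ^ k) * L (q ^ Suc k))"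
            using q(2) assms L by (intro mult_mono mult_left_mono) (auto simp: field_simps)
          then have "sqrt (64 * (2 * v * real (q ^ k) * L (q ^ k))) \<le> sqrt (e\<^sup>2 * (2 * v * real (q ^ Suc k) * L (q ^ Suc k)))"
            by (intro real_sqrt_le_mono) (simp add: mult_ac)
          moreover have "sqrt (64 * w) = 8 * sqrt w" "sqrt (e\<^sup>2 * w) = e * sqrt w" for w
            using assms real_sqrt_mult[of "8\<^sup>2" w] by (simp_all add: real_sqrt_mult)
          ultimately have "8 * sqrt (2 * v * real (q ^ k) * L (q ^ k)) \<le> e * sqrt (2 * v * real (q ^ Suc k) * L (q ^ Suc k))"
            by metis
          also have "sqrt (2 * v * real (q ^ Suc k) * L (q ^ Suc k)) = c * g"
            by (simp only: c_def g_def real_sqrt_mult)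
          finally have "8 * sqrt (2 * v * real (q ^ k) * L (q ^ k)) \<le> e * (c * g)" .
          then show ?thesis by simp
        qed
        have "S (q ^ Suc k) \<omega> = S (q ^ k) \<omega> + D k \<omega>"
          using q1 sum.atLeastLessThan_concat[of 0 "q ^ k" "q ^ Suc k" "\<lambda>l. Z l \<omega>"]
          by (simp add: S_def D_def atLeast0LessThan)
        with 1 2 elim(1) have "(1 - e / 4) * ((1 - e / 4) * (c * h)) - e / 4 * (c * g) \<le> S (q ^ Suc k) \<omega>"
          by linarith
        moreover have "(1 - e) * (c * g) \<le> (1 - e / 4) * ((1 - e / 4) * (c * h)) - e / 4 * (c * g)"
        proof -
          have "(1 - 3 * e / 4) * g \<le> (1 - 3 * e / 4) * ((1 + e / 4) * h)"
            using g assms by (intro mult_left_mono) auto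
          also have "\<dots> = (1 - e / 2 - 3 * e\<^sup>2 / 16) * h" by (simp add: power2_eq_square algebra_simps)
          also have "\<dots> \<le> (1 - e / 4)\<^sup>2 * h"
            using c by (intro mult_right_mono) (auto simp: power2_eq_square algebra_simps)
          finally have "c * ((1 - 3 * e / 4) * g) \<le> c * ((1 - e / 4)\<^sup>2 * h)"
            using c by (intro mult_left_mono) auto
          moreover have "(1 - e) * (c * g) + e / 4 * (c * g) = c * ((1 - 3 * e / 4) * g)"
            by (simp add: algebra_simps)
          moreover have "(1 - e / 4) * ((1 - e / 4) * (c * h)) = c * ((1 - e / 4)\<^sup>2 * h)"
            by (simp add: power2_eq_square mult_ac)
          ultimately show ?thesis by linarith
        qed
        ultimately show "(1 - e) * sqrt (2 * v * real (q ^ Suc k) * L (q ^ Suc k)) \<le> S (q ^ Suc k) \<omega>"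
          by (simp add: c_def g_def real_sqrt_mult)
      qed
    qed
    have "\<exists>\<^sub>F k in sequentially. (1 - e) * sqrt (2 * v * real (q ^ Suc k) * L (q ^ Suc k)) \<le> S (q ^ Suc k) \<omega>"
      by (rule frequently_rev_mp[OF D imp])
    moreover have "filterlim (\<lambda>k. q ^ Suc k) at_top sequentially"
      using qlim by (rule filterlim_compose) (rule filterlim_Suc)
    ultimately have "\<exists>\<^sub>F n in sequentially. (1 - e) * sqrt (2 * v * real n * L n) \<le> S n \<omega>"
      unfolding frequently_def using eventually_compose_filterlim by fast
    then show "\<exists>\<^sub>F n in sequentially. (1 - e) * sqrt (2 * v * real n * ln (ln (real n))) \<le> S n \<omega>"
      by (simp add: L_def)
  qed
qed

end

text \<open>Brings in the grid points 0 and 1, where the variance is zero and all the variables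
  vanish almost surely.\<close>

lemma (in bounded_iid) lil_upper_nonneg:
  assumes "0 < e"
  shows "AE \<omega> in M. \<forall>\<^sub>F n in sequentially. \<bar>S n \<omega>\<bar> \<le> (1 + e) * sqrt (2 * v * real n * ln (ln (real n)))"
proof (cases "v = 0")
  case True
  have "AE \<omega> in M. Z n \<omega> = 0" for n
    using integral_nonneg_eq_0_iff_AE[OF integrable_Z(2), of n] second_moment[of n] True by simp
  then have "AE \<omega> in M. \<forall>n. Z n \<omega> = 0"
    by (simp add: AE_all_countable)
  then show ?thesis
    by (rule AE_mp) (auto simp: S_def True)
next
  case False
  with v_nonneg lil_upper[of e] assms show ?thesis by simp
qed

section \<open>Uniform approximation of the empirical process on a finite grid\<close>

text \<open>Going from level \<open>j\<close> to level \<open>j - 1\<close> drops the last binary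
  digit of \<open>i\<close>: an even \<open>i\<close> stays at the same point, an odd one moves by a
  single increment of level \<open>j\<close>. After \<open>d\<close> levels the numerator is
  \<open>i div 2 ^ d\<close>, and the increments telescope.\<close>

lemma dyadic_chain:
  fixes h :: "real \<Rightarrow> real" and e :: "nat \<Rightarrow> real"
  assumes "\<And>j i. m < j \<Longrightarrow> j \<le> m + d \<Longrightarrow> i < 2 ^ j \<Longrightarrow> \<bar>h ((real i + 1) / 2 ^ j) - h (real i / 2 ^ j)\<bar> \<le> e j"
    and "\<And>j. 0 \<le> e j" and "i \<le> 2 ^ (m + d)"
  shows "\<bar>h (real i / 2 ^ (m + d)) - h (real (i div 2 ^ d) / 2 ^ m)\<bar> \<le> (\<Sum>j\<in>{m<..m + d}. e j)"
  using assms
proof (induction d arbitrary: i)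
  case (Suc d)
  let ?J = "m + Suc d"
  have half: "i div 2 \<le> 2 ^ (m + d)" using Suc.prems(3) by simp
  have "\<bar>h (real i / 2 ^ ?J) - h (real (i div 2) / 2 ^ (m + d))\<bar> \<le> e ?J"
  proof (cases "even i")
    case True
    then have "real i / 2 ^ ?J = real (i div 2) / 2 ^ (m + d)"
      by (auto elim!: evenE simp: field_simps)
    then show ?thesis using Suc.prems(2) by simp
  next
    case False
    then obtain l where l: "i = 2 * l + 1" by (auto elim: oddE)
    then have "2 * l < 2 ^ ?J" using Suc.prems(3) by simp
    from Suc.prems(1)[OF _ _ this] show ?thesis
      by (simp add: l field_simps)
  qed
  moreover have "\<bar>h (real (i div 2) / 2 ^ (m + d)) - h (real (i div 2 div 2 ^ d) / 2 ^ m)\<bar> \<le> (\<Sum>j\<in>{m<..m + d}. e j)"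
    using Suc.prems by (intro Suc.IH half) auto
  ultimately have "\<bar>h (real i / 2 ^ ?J) - h (real (i div 2 div 2 ^ d) / 2 ^ m)\<bar> \<le> e ?J + (\<Sum>j\<in>{m<..m + d}. e j)"
    by (rule order_trans[OF _ add_mono, rotated]) (rule order_trans[OF eq_refl abs_triangle_ineq], simp)
  moreover have "i div 2 div 2 ^ d = i div 2 ^ Suc d"
    by (simp add: div_mult2_eq)
  moreover have "(\<Sum>j\<in>{m<..?J}. e j) = e ?J + (\<Sum>j\<in>{m<..m + d}. e j)"
  proof -
    have "{m<..?J} = insert ?J {m<..m + d}" by auto
    then show ?thesis by simp
  qed
  ultimately show ?case by simp
qed simp

section \<open>Empirical deviations under a continuous distribution function\<close>

locale iid_continuous = prob_space +
  fixes Y :: "nat \<Rightarrow> 'a \<Rightarrow> real" and F :: "real \<Rightarrow> real"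
  assumes indep_Y: "indep_vars (\<lambda>_. borel) Y UNIV"
    and cdf_Y: "cdf (distr M borel (Y n)) = F"
    and cont_F: "continuous_on UNIV F"
begin

definition \<mu> :: "real measure" where "\<mu> = distr M borel (Y 0)"

text \<open>For \<open>A = {..t}\<close> this is \<open>sqrt n\<close> times the ordinary empirical
  process at \<open>t\<close>. Without normalisation it is, for fixed \<open>A\<close>, a random
  walk in \<open>n\<close>, so the maximal inequality applies; general sets \<open>A\<close> also
  cover the increments between grid points.\<close>

definition dev :: "real set \<Rightarrow> nat \<Rightarrow> 'a \<Rightarrow> real" where
  "dev A n \<omega> = (\<Sum>l<n. indicator A (Y l \<omega>)) - real n * measure \<mu> A"

lemma Y_measurable [measurable]: "Y n \<in> borel_measurable M"
  using indep_Y by (auto simp: indep_vars_def)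

lemma distr_Y: "distr M borel (Y n) = \<mu>"
  unfolding \<mu>_def by (intro cdf_unique real_distribution_distr) (simp_all add: cdf_Y)

sublocale D: real_distribution \<mu>
  unfolding \<mu>_def by (rule real_distribution_distr) simp

lemma cdf_\<mu>: "cdf \<mu> = F"
  by (simp add: \<mu>_def cdf_Y)

lemma F_mono: "x \<le> y \<Longrightarrow> F x \<le> F y"
  using D.cdf_nondecreasing by (simp add: cdf_\<mu>)

lemma F_bounds: "0 \<le> F x" "F x \<le> 1"
  using D.cdf_nonneg[of x] D.cdf_bounded_prob[of x] by (simp_all add: cdf_\<mu>)

lemma measure_atMost: "measure \<mu> {..t} = F t"
  using cdf_\<mu> by (simp add: cdf_def fun_eq_iff)

lemma F_measurable [measurable]: "F \<in> borel_measurable borel"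
  using D.cdf_borel by (simp add: cdf_\<mu>)

lemma bounded_iid_dev:
  assumes A: "A \<in> sets borel"
  shows "bounded_iid M (\<lambda>n \<omega>. indicator A (Y n \<omega>) - measure \<mu> A) (measure \<mu> A * (1 - measure \<mu> A))"
proof unfold_locales
  note [measurable] = A
  let ?p = "measure \<mu> A"
  have p: "0 \<le> ?p" "?p \<le> 1" by auto
  have int: "integrable M (\<lambda>\<omega>. indicator A (Y n \<omega>) :: real)" for n
    by (rule integrable_const_bound[where B=1]) auto
  have ex: "expectation (\<lambda>\<omega>. indicator A (Y n \<omega>)) = ?p" for n
  proof -
    have "expectation (\<lambda>\<omega>. indicator A (Y n \<omega>)) = integral\<^sup>L \<mu> (indicator A :: real \<Rightarrow> real)"
      unfolding distr_Y[of n, symmetric] by (subst integral_distr) auto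
    then show ?thesis by simp
  qed
  show "indep_vars (\<lambda>_. borel) (\<lambda>n \<omega>. indicator A (Y n \<omega>) - ?p) UNIV"
    by (rule indep_vars_compose2[OF indep_Y, of "\<lambda>_ x. indicator A x - ?p"]) measurable
  show "\<bar>indicator A (Y n \<omega>) - ?p\<bar> \<le> 1" for n \<omega>
    using p by (auto split: split_indicator)
  show "expectation (\<lambda>\<omega>. indicator A (Y n \<omega>) - ?p) = 0" for n
    using int ex by (simp add: prob_space)
  show "expectation (\<lambda>\<omega>. (indicator A (Y n \<omega>) - ?p)\<^sup>2) = ?p * (1 - ?p)" for n
  proof -
    have "(indicator A x - ?p)\<^sup>2 = (1 - 2 * ?p) * indicator A x + ?p\<^sup>2" for x :: real
      by (auto simp: power2_eq_square algebra_simps split: split_indicator)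
    then show ?thesis
      using int ex by (simp add: prob_space) (simp add: power2_eq_square algebra_simps)
  qed
  show "distr M borel (\<lambda>\<omega>. indicator A (Y n \<omega>) - ?p) = distr M borel (\<lambda>\<omega>. indicator A (Y 0 \<omega>) - ?p)" for n
  proof -
    have "distr M borel (\<lambda>\<omega>. indicator A (Y n \<omega>) - ?p) = distr (distr M borel (Y n)) borel (\<lambda>x. indicator A x - ?p)" for n
      by (subst distr_distr) (auto simp: comp_def)
    then show ?thesis by (simp add: distr_Y)
  qed
qed

lemma S_eq_dev:
  assumes "A \<in> sets borel"
  shows "bounded_iid.S (\<lambda>n \<omega>. indicator A (Y n \<omega>) - measure \<mu> A) = dev A"
proof -
  interpret b: bounded_iid M "\<lambda>n \<omega>. indicator A (Y n \<omega>) - measure \<mu> A" "measure \<mu> A * (1 - measure \<mu> A)"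
    by (rule bounded_iid_dev[OF assms])
  show ?thesis by (auto simp: b.S_def dev_def sum_subtractf fun_eq_iff)
qed

lemma
  assumes A: "A \<in> sets borel"
  defines "v \<equiv> measure \<mu> A * (1 - measure \<mu> A)"
  shows dev_maximal: "\<lbrakk>real N * v \<le> V; 0 < x; x \<le> V\<rbrakk> \<Longrightarrow>
      prob {\<omega> \<in> space M. \<exists>n\<le>N. x \<le> \<bar>dev A n \<omega>\<bar>} \<le> 2 * exp (- (x\<^sup>2 / (2 * V) * (1 - x / V)))"
    and dev_lil_upper: "0 < e \<Longrightarrow> AE \<omega> in M. \<forall>\<^sub>F n in sequentially.
      \<bar>dev A n \<omega>\<bar> \<le> (1 + e) * sqrt (2 * v * real n * ln (ln (real n)))"
    and dev_lil_lower: "\<lbrakk>0 < v; 0 < e; e \<le> 1\<rbrakk> \<Longrightarrow> AE \<omega> in M. \<exists>\<^sub>F n in sequentially.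
      (1 - e) * sqrt (2 * v * real n * ln (ln (real n))) \<le> dev A n \<omega>"
proof -
  interpret b: bounded_iid M "\<lambda>n \<omega>. indicator A (Y n \<omega>) - measure \<mu> A" v
    unfolding v_def by (rule bounded_iid_dev[OF A])
  note [simp] = S_eq_dev[OF A]
  show "\<lbrakk>real N * v \<le> V; 0 < x; x \<le> V\<rbrakk> \<Longrightarrow>
      prob {\<omega> \<in> space M. \<exists>n\<le>N. x \<le> \<bar>dev A n \<omega>\<bar>} \<le> 2 * exp (- (x\<^sup>2 / (2 * V) * (1 - x / V)))"
    using b.maximal_abs[of N V x] by simp
  show "0 < e \<Longrightarrow> AE \<omega> in M. \<forall>\<^sub>F n in sequentially.
      \<bar>dev A n \<omega>\<bar> \<le> (1 + e) * sqrt (2 * v * real n * ln (ln (real n)))"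
    using b.lil_upper_nonneg[of e] by simp
  show "\<lbrakk>0 < v; 0 < e; e \<le> 1\<rbrakk> \<Longrightarrow> AE \<omega> in M. \<exists>\<^sub>F n in sequentially.
      (1 - e) * sqrt (2 * v * real n * ln (ln (real n))) \<le> dev A n \<omega>"
    using b.lil_lower[of e] by simp
qed

lemma dev_measurable [measurable]:
  assumes "A \<in> sets borel" shows "dev A n \<in> borel_measurable M"
  using bounded_iid.S_measurable[OF bounded_iid_dev[OF assms]] by (simp add: S_eq_dev[OF assms])

lemma dev_Diff:
  assumes "A \<in> sets borel" "B \<in> sets borel" "A \<subseteq> B"
  shows "dev (B - A) n \<omega> = dev B n \<omega> - dev A n \<omega>"
proof -
  have "indicator (B - A) x = (indicator B x - indicator A x :: real)" for x
    using assms(3) by (auto split: split_indicator)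
  moreover have "measure \<mu> (B - A) = measure \<mu> B - measure \<mu> A"
    using assms by (intro D.finite_measure_Diff) auto
  ultimately have "dev (B - A) n \<omega> =
      (\<Sum>l<n. indicator B (Y l \<omega>) - indicator A (Y l \<omega>)) - real n * (measure \<mu> B - measure \<mu> A)"
    by (simp only: dev_def)
  then show ?thesis
    by (simp only: dev_def sum_subtractf right_diff_distrib)
qed

text \<open>The event that the uniform variable \<open>F (Y n)\<close> lies below \<open>u\<close>.
  Indexing by values of \<open>F\<close> avoids choosing quantiles, which may fail to exist for
  \<open>u = 0\<close> and \<open>u = 1\<close>.\<close>

definition G :: "real \<Rightarrow> real set" where "G u = {x. F x < u}"

lemma G_sets [measurable]: "G u \<in> sets borel"
  unfolding G_def by measurable

lemma F_surj:
  assumes "0 < u" "u < 1"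
  obtains t where "F t = u"
proof -
  have "\<forall>\<^sub>F x in at_bot. F x < u"
    using order_tendstoD(2)[OF D.cdf_lim_at_bot assms(1)] by (simp add: cdf_\<mu>)
  then obtain a where a: "F a < u" by (auto simp: eventually_at_bot_linorder)
  have "\<forall>\<^sub>F x in at_top. u < F x"
    using order_tendstoD(1)[OF D.cdf_lim_at_top_prob assms(2)] by (simp add: cdf_\<mu>)
  then obtain b where b: "u < F b" by (auto simp: eventually_at_top_linorder)
  have "a \<le> b" using a b F_mono[of b a] by linarith
  then have "\<exists>x\<ge>a. x \<le> b \<and> F x = u"
    using a b cont_F by (intro IVT') (auto intro: continuous_on_subset)
  then show thesis using that by blast
qed

text \<open>The probability integral transform: a continuous \<open>F\<close> attains every
  \<open>w\<close> strictly between 0 and 1, and a half-line \<open>{..t}\<close> with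
  \<open>F t = w\<close> has measure exactly \<open>w\<close>.\<close>

lemma measure_G:
  assumes "0 \<le> u" "u \<le> 1"
  shows "measure \<mu> (G u) = u"
proof (rule antisym)
  show "measure \<mu> (G u) \<le> u"
  proof -
    consider "u = 0" | "u = 1" | "0 < u" "u < 1" using assms by linarith
    then show ?thesis
    proof cases
      case 1
      then have "G u = {}" using F_bounds by (auto simp: G_def not_less)
      then show ?thesis using assms by simp
    next
      case 3
      then obtain t where t: "F t = u" by (rule F_surj)
      have "G u \<subseteq> {..t}"
      proof
        fix x assume "x \<in> G u"
        then have "\<not> F t \<le> F x" using t by (simp add: G_def)
        then show "x \<in> {..t}" using F_mono[of t x] by force
      qed
      then have "measure \<mu> (G u) \<le> measure \<mu> {..t}"
        by (intro D.finite_measure_mono) auto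
      then show ?thesis by (simp add: measure_atMost t)
    qed simp
  qed
  show "u \<le> measure \<mu> (G u)"
  \<comment> \<open>Approximation from below, since a half-line \<open>{..t}\<close> with
    \<open>F t = u\<close> need not lie in \<open>G u\<close>, and for \<open>u = 1\<close> no such
    \<open>t\<close> need exist.\<close>
  proof (rule dense_le)
    fix w assume "w < u"
    show "w \<le> measure \<mu> (G u)"
    proof (cases "0 < w")
      case True
      moreover have "w < 1" using \<open>w < u\<close> assms by linarith
      ultimately obtain t where t: "F t = w" by (rule F_surj)
      have "{..t} \<subseteq> G u"
      proof
        fix y assume "y \<in> {..t}"
        then have "F y \<le> w" using F_mono[of y t] t by simp
        then show "y \<in> G u" using \<open>w < u\<close> by (simp add: G_def)
      qed
      then have "measure \<mu> {..t} \<le> measure \<mu> (G u)"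
        by (intro D.finite_measure_mono) auto
      then show ?thesis by (simp add: measure_atMost t)
    next
      case False
      then show ?thesis using measure_nonneg[of \<mu> "G u"] by linarith
    qed
  qed
qed

section \<open>Chaining along dyadic levels\<close>

text \<open>For \<open>n \<le> 4 ^ k\<close> an increment of level \<open>j\<close> has variance at
  most \<open>4 ^ k / 2 ^ j\<close>, and \<open>dev_maximal\<close> handles all these
  \<open>n\<close> together. The bounds are summable in \<open>j\<close>, as
  \<open>dyadic_chain\<close> requires; a small \<open>e\<close> is paid for by starting at a late
  level.\<close>

lemma oscillation:
  assumes "0 < e"
  shows "\<exists>m0. \<forall>m\<ge>m0. AE \<omega> in M. \<forall>\<^sub>F k in sequentially. \<forall>j i n. m < j \<longrightarrow> j \<le> k \<longrightarrow> i < 2 ^ j \<longrightarrow> n \<le> 4 ^ k \<longrightarrow>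
    \<bar>dev (G ((real i + 1) / 2 ^ j)) n \<omega> - dev (G (real i / 2 ^ j)) n \<omega>\<bar> \<le> e * (3 / 4) ^ j * sqrt (4 ^ k * ln (real k))"
proof -
  \<comment> \<open>The right side is the coefficient of \<open>ln k\<close> in the exponent of the
    tail. On the left, \<open>2\<close> yields the summable \<open>k powr (- 2)\<close>, and
    \<open>j\<close> yields \<open>k\<close> to the power \<open>- j\<close>, which outweighs the
    \<open>2 ^ j\<close> increments of that level.\<close>
  have "\<forall>\<^sub>F j in sequentially. 2 + real j \<le> e\<^sup>2 / 4 * (9 / 8) ^ j"
    using assms by real_asymp
  then obtain m0 where m0: "\<And>j. m0 \<le> j \<Longrightarrow> 2 + real j \<le> e\<^sup>2 / 4 * (9 / 8) ^ j"
    by (auto simp: eventually_sequentially)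
  define C where "C j i = G ((real i + 1) / 2 ^ j) - G (real i / 2 ^ j)" for j i :: nat
  have C_sets [measurable]: "C j i \<in> sets borel" for j i by (simp add: C_def)
  have sub: "G (real i / 2 ^ j) \<subseteq> G ((real i + 1) / 2 ^ j)" for i j :: nat
    by (auto simp: G_def elim!: less_le_trans intro!: divide_right_mono)
  have dev_C: "dev (C j i) n \<omega> = dev (G ((real i + 1) / 2 ^ j)) n \<omega> - dev (G (real i / 2 ^ j)) n \<omega>" for i j n \<omega>
    unfolding C_def by (rule dev_Diff[OF G_sets G_sets sub])
  have measure_C: "measure \<mu> (C j i) = 1 / 2 ^ j" if "i < 2 ^ j" for i j
  proof -
    have "real i + 1 \<le> 2 ^ j"
      using that by (metis Suc_leI of_nat_Suc of_nat_le_iff of_nat_numeral of_nat_power add.commute)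
    moreover from this have "real i \<le> 2 ^ j" by linarith
    ultimately have "measure \<mu> (G ((real i + 1) / 2 ^ j)) = (real i + 1) / 2 ^ j" "measure \<mu> (G (real i / 2 ^ j)) = real i / 2 ^ j"
      by (simp_all add: measure_G)
    then show ?thesis
      unfolding C_def using D.finite_measure_Diff[OF _ _ sub[of i j]] by (simp add: diff_divide_distrib[symmetric])
  qed
  define x where "x j k = e * (3 / 4) ^ j * sqrt (4 ^ k * ln (real k))" for j k
  define E where "E j i k = {\<omega> \<in> space M. \<exists>n\<le>4 ^ k. x j k \<le> \<bar>dev (C j i) n \<omega>\<bar>}" for j i k
  have E_sets [measurable]: "E j i k \<in> events" for j i k
    unfolding E_def Bex_def[symmetric] atMost_iff[symmetric]
    by (intro sets.sets_Collect_finite_Ex borel_measurable_le) auto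
  have "\<forall>\<^sub>F k in sequentially. 2 * e * sqrt (ln (real k)) \<le> (4 / 3) ^ k"
    using assms by real_asymp
  then have bound: "\<forall>\<^sub>F k in sequentially. \<forall>j i. m0 \<le> j \<longrightarrow> j \<le> k \<longrightarrow> i < 2 ^ j \<longrightarrow>
      prob (E j i k) \<le> 2 * exp (- ((2 + real j) * ln (real k)))"
    using eventually_ge_at_top[of 2]
  proof eventually_elim
    case (elim k)
    show ?case
    proof (intro allI impI)
      fix j i :: nat assume j: "m0 \<le> j" "j \<le> k" "i < 2 ^ j"
      define V :: real where "V = 4 ^ k / 2 ^ j"
      have V: "0 < V" by (simp add: V_def)
      have lnk: "0 < ln (real k)" using elim by simp
      have x: "0 < x j k" using assms lnk by (simp add: x_def)
      have sqrt4: "sqrt (4 ^ k * ln (real k)) = 2 ^ k * sqrt (ln (real k))"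
        by (simp add: real_sqrt_mult real_sqrt_power)
      \<comment> \<open>This is where \<open>j \<le> k\<close> enters: down to that level the
        threshold stays below half of \<open>V\<close>, so the correction \<open>1 - x / V\<close>
        of the exponential inequality costs at most a factor 2 in the exponent.\<close>
      have half: "x j k \<le> V / 2"
      proof -
        have "(3 / 2 :: real) ^ j \<le> (3 / 2) ^ k" using j by (intro power_increasing) auto
        then have "(3 / 2) ^ j * (2 * e * sqrt (ln (real k))) \<le> (3 / 2) ^ k * (4 / 3) ^ k"
          using elim(1) assms lnk by (intro mult_mono) auto
        also have "\<dots> = 2 ^ k" by (simp add: power_mult_distrib[symmetric])
        finally have "(3 / 2) ^ j * (2 * e * sqrt (ln (real k))) * (2 ^ k / 2 ^ j) \<le> 2 ^ k * (2 ^ k / 2 ^ j)"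
          by (intro mult_right_mono) auto
        moreover have "(3 / 2 :: real) ^ j = (3 / 4) ^ j * 2 ^ j" by (simp add: power_mult_distrib[symmetric])
        moreover have "(4 :: real) ^ k = 2 ^ k * 2 ^ k" by (simp add: power_mult_distrib[symmetric])
        ultimately have "2 * x j k \<le> V"
          unfolding x_def sqrt4 V_def by (simp add: mult_ac)
        then show ?thesis by simp
      qed
      \<comment> \<open>The threshold shrinks slower than the standard deviation of an increment of level \<open>j\<close>,
        since \<open>(3 / 4)\<^sup>2 > 1 / 2\<close>; this compensates the number \<open>2 ^ j\<close> of increments.\<close>
      have "prob (E j i k) \<le> 2 * exp (- ((x j k)\<^sup>2 / (2 * V) * (1 - x j k / V)))"
        unfolding E_def
      proof (rule dev_maximal[OF C_sets _ x])
        have "1 / 2 ^ j * (1 - 1 / 2 ^ j) \<le> (1 / 2 ^ j :: real)"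
          by (intro mult_left_le) auto
        then have "4 ^ k * (1 / 2 ^ j * (1 - 1 / 2 ^ j)) \<le> 4 ^ k * (1 / 2 ^ j :: real)"
          by (intro mult_left_mono) auto
        then show "real (4 ^ k) * (measure \<mu> (C j i) * (1 - measure \<mu> (C j i))) \<le> V"
          unfolding measure_C[OF j(3)] V_def by simp
      qed (use half V in linarith)
      also have "\<dots> \<le> 2 * exp (- ((2 + real j) * ln (real k)))"
      proof -
        have "(2 + real j) * ln (real k) \<le> e\<^sup>2 / 4 * (9 / 8) ^ j * ln (real k)"
          using m0[OF j(1)] lnk by (intro mult_right_mono) auto
        also have "\<dots> = (x j k)\<^sup>2 / (2 * V) * (1 / 2)"
        proof -
          have "(9 / 8 :: real) ^ j = ((3 / 4) ^ j)\<^sup>2 * 2 ^ j"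
            by (simp add: power_mult_distrib[symmetric] power2_eq_square)
          then show ?thesis
            using lnk by (simp add: x_def V_def power_mult_distrib)
        qed
        also have "\<dots> \<le> (x j k)\<^sup>2 / (2 * V) * (1 - x j k / V)"
          using half V by (intro mult_left_mono) (auto simp: field_simps)
        finally show ?thesis by simp
      qed
      finally show "prob (E j i k) \<le> 2 * exp (- ((2 + real j) * ln (real k)))" .
    qed
  qed
  have "AE \<omega> in M. \<forall>\<^sub>F k in sequentially. \<forall>j i n. m < j \<longrightarrow> j \<le> k \<longrightarrow> i < 2 ^ j \<longrightarrow> n \<le> 4 ^ k \<longrightarrow>
    \<bar>dev (C j i) n \<omega>\<bar> \<le> x j k" if m: "m0 \<le> m" for m
  proof -
    define U where "U k = (\<Union>j\<in>{m<..k}. \<Union>i\<in>{..<2^j}. E j i k)" for k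
    have U [measurable]: "U k \<in> events" for k unfolding U_def by measurable
    have U_le: "\<forall>\<^sub>F k in sequentially. prob (U k) \<le> 2 * real k powr (- 2)"
      using bound eventually_ge_at_top[of 4]
    proof eventually_elim
      case (elim k)
      have "prob (U k) \<le> (\<Sum>j\<in>{m<..k}. prob (\<Union>i\<in>{..<2^j}. E j i k))"
        unfolding U_def by (intro finite_measure_subadditive_finite) auto
      also have "\<dots> \<le> (\<Sum>j\<in>{m<..k}. 2 * real k powr (- 2) * (1 / 2) ^ j)"
      proof (rule sum_mono)
        fix j assume j: "j \<in> {m<..k}"
        have "prob (\<Union>i\<in>{..<2^j}. E j i k) \<le> (\<Sum>i\<in>{..<2^j}. prob (E j i k))"
          by (intro finite_measure_subadditive_finite) auto
        also have "\<dots> \<le> (\<Sum>i\<in>{..<2^j::nat}. 2 * exp (- ((2 + real j) * ln (real k))))"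
          using elim j m by (intro sum_mono) auto
        also have "\<dots> = 2 * (2 ^ j * exp (- ((2 + real j) * ln (real k))))"
          by simp
        also have "exp (- ((2 + real j) * ln (real k))) = real k powr (- 2) * (1 / real k) ^ j"
        proof -
          have "exp (- ((2 + real j) * ln (real k))) = real k powr (- 2) * real k powr (- real j)"
            using elim by (simp add: powr_def exp_add[symmetric] algebra_simps)
          then show ?thesis using elim by (simp add: powr_minus powr_realpow power_inverse divide_inverse)
        qed
        also have "2 * (2 ^ j * (real k powr (- 2) * (1 / real k) ^ j)) = 2 * real k powr (- 2) * (2 * (1 / real k)) ^ j"
          by (simp only: power_mult_distrib mult_ac)
        \<comment> \<open>Here \<open>k \<ge> 4\<close> makes \<open>2 / k\<close> at most
          \<open>1 / 2\<close>, so the sum over all levels is geometric.\<close>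
        also have "\<dots> \<le> 2 * real k powr (- 2) * (1 / 2) ^ j"
          using elim by (intro mult_left_mono power_mono) (auto simp: field_simps)
        finally show "prob (\<Union>i\<in>{..<2^j}. E j i k) \<le> 2 * real k powr (- 2) * (1 / 2) ^ j" .
      qed
      also have "\<dots> = 2 * real k powr (- 2) * (\<Sum>j\<in>{m<..k}. (1 / 2) ^ j)"
        by (simp add: sum_distrib_left)
      also have "\<dots> \<le> 2 * real k powr (- 2) * 1"
      proof (rule mult_left_mono)
        have "(\<Sum>j\<in>{m<..k}. (1 / 2 :: real) ^ j) \<le> (\<Sum>j\<in>{0<..k}. (1 / 2) ^ j)"
          by (intro sum_mono2) auto
        also have "\<dots> = 1 - (1 / 2) ^ k"
        proof (induction k)
          case (Suc k)
          have "{0<..Suc k} = insert (Suc k) {0<..k}" by auto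
          then show ?case using Suc by simp
        qed simp
        finally show "(\<Sum>j\<in>{m<..k}. (1 / 2 :: real) ^ j) \<le> 1"
          using zero_le_power[of "1 / 2 :: real" k] by linarith
      qed simp
      finally show ?case by simp
    qed
    have "summable (\<lambda>k. 2 * real k powr (- 2))"
      by (intro summable_mult) (simp only: summable_real_powr_iff)
    then have "summable (\<lambda>k. prob (U k))"
      by (rule summable_comparison_test_ev[rotated]) (use U_le in \<open>simp only: real_norm_def abs_of_nonneg measure_nonneg\<close>)
    then have "AE \<omega> in M. \<forall>\<^sub>F k in sequentially. \<omega> \<in> space M - U k"
      by (intro borel_cantelli_AE1 U) (simp_all add: emeasure_eq_measure)
    then show ?thesis
    proof (rule AE_mp, intro AE_I2 impI)
      fix \<omega> assume "\<omega> \<in> space M" "\<forall>\<^sub>F k in sequentially. \<omega> \<in> space M - U k"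
      from this(2) show "\<forall>\<^sub>F k in sequentially. \<forall>j i n. m < j \<longrightarrow> j \<le> k \<longrightarrow> i < 2 ^ j \<longrightarrow> n \<le> 4 ^ k \<longrightarrow> \<bar>dev (C j i) n \<omega>\<bar> \<le> x j k"
      proof eventually_elim
        case (elim k)
        show ?case
        proof (intro allI impI)
          fix j i n :: nat assume "m < j" "j \<le> k" "i < 2 ^ j" "n \<le> 4 ^ k"
          with elim have "\<omega> \<notin> E j i k" unfolding U_def by auto
          with \<open>n \<le> 4 ^ k\<close> \<open>\<omega> \<in> space M\<close> have "\<not> x j k \<le> \<bar>dev (C j i) n \<omega>\<bar>"
            unfolding E_def by blast
          then show "\<bar>dev (C j i) n \<omega>\<bar> \<le> x j k" by simp
        qed
      qed
    qed
  qed
  then show ?thesis unfolding dev_C x_def by blast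
qed


text \<open>The counts are monotone in the set, so comparison with a neighbouring grid set moves
  only the centring, by at most \<open>n / 2 ^ k\<close>. A nonpositive deviation is compared with
  the grid point below \<open>F t\<close>, a positive one with the grid point above.\<close>

lemma dev_sandwich:
  "\<exists>i\<le>2 ^ k. \<bar>real i / 2 ^ k - F t\<bar> \<le> 1 / 2 ^ k \<and>
     \<bar>dev {..t} n \<omega>\<bar> \<le> \<bar>dev (G (real i / 2 ^ k)) n \<omega>\<bar> + real n / 2 ^ k"
proof -
  define i where "i = nat \<lfloor>2 ^ k * F t\<rfloor>"
  define N where "N A = (\<Sum>l<n. indicator A (Y l \<omega>) :: real)" for A
  have N_mono: "N A \<le> N B" if "A \<subseteq> B" for A B
    unfolding N_def using that by (intro sum_mono) (auto split: split_indicator)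
  have i_ge: "real i \<le> 2 ^ k * F t" and i_less: "2 ^ k * F t < real i + 1"
    using F_bounds[of t] unfolding i_def by (auto simp: of_nat_nat intro!: of_int_floor_le)
  have i_le: "real i \<le> 2 ^ k"
    using mult_left_mono[OF F_bounds(2)[of t], of "2 ^ k"] by (intro order_trans[OF i_ge]) simp
  have b1: "real i / 2 ^ k \<le> F t" using i_ge by (simp add: field_simps)
  have "F t < (real i + 1) / 2 ^ k" using i_less by (simp add: field_simps)
  then have b2: "F t < real i / 2 ^ k + 1 / 2 ^ k" by (simp add: add_divide_distrib)
  have b3: "real (Suc i) / 2 ^ k = real i / 2 ^ k + 1 / 2 ^ k" by (simp add: add_divide_distrib)
  have dev_G: "dev (G u) n \<omega> = N (G u) - real n * u" if "0 \<le> u" "u \<le> 1" for u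
    using measure_G[OF that] by (simp add: dev_def N_def)
  have dev_t: "dev {..t} n \<omega> = N {..t} - real n * F t"
    by (simp add: dev_def N_def measure_atMost)
  have "G (real i / 2 ^ k) \<subseteq> {..t}"
  proof
    fix x assume "x \<in> G (real i / 2 ^ k)"
    then have "F x < F t" using b1 by (simp add: G_def)
    then show "x \<in> {..t}" using F_mono[of t x] by force
  qed
  then have "N (G (real i / 2 ^ k)) \<le> N {..t}" by (rule N_mono)
  moreover have "real n * F t \<le> real n * (real i / 2 ^ k) + real n / 2 ^ k"
  proof -
    have "F t \<le> real i / 2 ^ k + 1 / 2 ^ k" using b2 by simp
    from mult_left_mono[OF this, of "real n"] show ?thesis by (simp add: distrib_left)
  qed
  ultimately have lower: "dev (G (real i / 2 ^ k)) n \<omega> - real n / 2 ^ k \<le> dev {..t} n \<omega>"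
    using i_le by (subst dev_G) (simp_all add: dev_t)
  have lo: "\<bar>real i / 2 ^ k - F t\<bar> \<le> 1 / 2 ^ k"
    using b1 b2 by linarith
  show ?thesis
  proof (cases "dev {..t} n \<omega> \<le> 0")
    case True
    then have "\<bar>dev {..t} n \<omega>\<bar> \<le> \<bar>dev (G (real i / 2 ^ k)) n \<omega>\<bar> + real n / 2 ^ k"
      using lower by linarith
    then show ?thesis using lo i_le by (metis of_nat_le_iff of_nat_numeral of_nat_power)
  next
    case False
    \<comment> \<open>The upper neighbour must still belong to the grid. If \<open>F t = 1\<close>,
      the deviation is a count minus \<open>n\<close>, hence not positive.\<close>
    have "F t < 1"
    proof (rule ccontr)
      assume "\<not> F t < 1"
      then have "F t = 1" using F_bounds[of t] by simp
      moreover have "N {..t} \<le> N UNIV" by (rule N_mono) simp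
      ultimately show False using False by (simp add: dev_t N_def)
    qed
    then have "2 ^ k * F t < 2 ^ k" by simp
    then have "real i < 2 ^ k" using i_ge by linarith
    then have "i < 2 ^ k" by (metis of_nat_less_iff of_nat_numeral of_nat_power)
    then have Suc_le: "Suc i \<le> 2 ^ k" by simp
    then have Suc_le': "real (Suc i) \<le> 2 ^ k" by (metis of_nat_le_iff of_nat_numeral of_nat_power)
    have "{..t} \<subseteq> G (real (Suc i) / 2 ^ k)"
    proof
      fix x assume "x \<in> {..t}"
      then have "F x \<le> F t" by (intro F_mono) simp
      then show "x \<in> G (real (Suc i) / 2 ^ k)" using b2 b3 by (simp add: G_def)
    qed
    then have "N {..t} \<le> N (G (real (Suc i) / 2 ^ k))" by (rule N_mono)
    moreover have "real n * (real (Suc i) / 2 ^ k) \<le> real n * F t + real n / 2 ^ k"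
    proof -
      have "real (Suc i) / 2 ^ k \<le> F t + 1 / 2 ^ k" using b1 b3 by simp
      from mult_left_mono[OF this, of "real n"] show ?thesis by (simp add: distrib_left)
    qed
    ultimately have "dev {..t} n \<omega> \<le> dev (G (real (Suc i) / 2 ^ k)) n \<omega> + real n / 2 ^ k"
      using Suc_le' by (subst dev_G) (simp_all add: dev_t)
    then have "\<bar>dev {..t} n \<omega>\<bar> \<le> \<bar>dev (G (real (Suc i) / 2 ^ k)) n \<omega>\<bar> + real n / 2 ^ k"
      using False by linarith
    moreover have "\<bar>real (Suc i) / 2 ^ k - F t\<bar> \<le> 1 / 2 ^ k"
      using b1 b2 b3 by linarith
    ultimately show ?thesis using Suc_le by blast
  qed
qed

text \<open>The grid must stay fixed as \<open>n\<close> grows. Sandwiching is therefore done at a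
  level \<open>k\<close> with \<open>2 ^ k\<close> of order \<open>sqrt n\<close>, where the
  rounding error \<open>n / 2 ^ k\<close> is at most \<open>sqrt n\<close>, and the chain then
  descends from level \<open>k\<close> to the fixed level \<open>m\<close>.\<close>

lemma uniform_approx:
  assumes "0 < e"
  shows "\<exists>m. 1 / 2 ^ m \<le> e \<and> (AE \<omega> in M. \<forall>\<^sub>F n in sequentially. \<forall>t. \<exists>i\<le>2 ^ m.
    \<bar>real i / 2 ^ m - F t\<bar> \<le> 2 * e \<and>
    \<bar>dev {..t} n \<omega>\<bar> \<le> \<bar>dev (G (real i / 2 ^ m)) n \<omega>\<bar> + e * sqrt (real n * ln (ln (real n))))"
proof -
  \<comment> \<open>Chaining costs \<open>16 * c\<close>: a factor 4 from replacing
    \<open>4 ^ k * ln k\<close> by \<open>n * ln (ln n)\<close> under the root, and a factor 4 from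
    the geometric series with ratio \<open>3 / 4\<close>. Sandwiching costs one more
    \<open>c\<close>.\<close>
  define c where "c = e / 17"
  have c: "0 < c" using assms by (simp add: c_def)
  obtain m0 where m0: "\<And>m. m0 \<le> m \<Longrightarrow> AE \<omega> in M. \<forall>\<^sub>F k in sequentially. \<forall>j i n. m < j \<longrightarrow> j \<le> k \<longrightarrow> i < 2 ^ j \<longrightarrow> n \<le> 4 ^ k \<longrightarrow>
    \<bar>dev (G ((real i + 1) / 2 ^ j)) n \<omega> - dev (G (real i / 2 ^ j)) n \<omega>\<bar> \<le> c * (3 / 4) ^ j * sqrt (4 ^ k * ln (real k))"
    using oscillation[OF c] by blast
  have "\<forall>\<^sub>F m in sequentially. 1 / 2 ^ m \<le> e" using assms by real_asymp
  then obtain m1 where m1: "\<And>m. m1 \<le> m \<Longrightarrow> 1 / 2 ^ m \<le> e" by (auto simp: eventually_sequentially)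
  define m where "m = max m0 m1"
  have m: "1 / 2 ^ m \<le> e" by (rule m1) (simp add: m_def)
  \<comment> \<open>Rounding up gives \<open>n \<le> 4 ^ k \<le> 4 * n\<close>, so \<open>n\<close>
    lies in the range covered by \<open>oscillation\<close> and \<open>2 ^ k\<close> is at least
    \<open>sqrt n\<close>.\<close>
  define K where "K n = nat \<lceil>log 4 (real n)\<rceil>" for n :: nat
  have K: "filterlim K at_top sequentially"
    unfolding K_def by real_asymp
  have ln: "\<forall>\<^sub>F n in sequentially. ln (log 4 (real n) + 1) \<le> 4 * ln (ln (real n))"
    by real_asymp
  have small: "\<forall>\<^sub>F n in sequentially. 1 \<le> c * sqrt (ln (ln (real n)))"
    using c by real_asymp
  have "AE \<omega> in M. \<forall>\<^sub>F n in sequentially. \<forall>t. \<exists>i\<le>2 ^ m.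
    \<bar>real i / 2 ^ m - F t\<bar> \<le> 2 * e \<and>
    \<bar>dev {..t} n \<omega>\<bar> \<le> \<bar>dev (G (real i / 2 ^ m)) n \<omega>\<bar> + e * sqrt (real n * ln (ln (real n)))"
  proof (rule AE_mp[OF m0[of m]], simp add: m_def, intro AE_I2 impI)
    fix \<omega>
    assume osc: "\<forall>\<^sub>F k in sequentially. \<forall>j i n. m < j \<longrightarrow> j \<le> k \<longrightarrow> i < 2 ^ j \<longrightarrow> n \<le> 4 ^ k \<longrightarrow>
      \<bar>dev (G ((real i + 1) / 2 ^ j)) n \<omega> - dev (G (real i / 2 ^ j)) n \<omega>\<bar> \<le> c * (3 / 4) ^ j * sqrt (4 ^ k * ln (real k))"
    show "\<forall>\<^sub>F n in sequentially. \<forall>t. \<exists>i\<le>2 ^ m.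
      \<bar>real i / 2 ^ m - F t\<bar> \<le> 2 * e \<and>
      \<bar>dev {..t} n \<omega>\<bar> \<le> \<bar>dev (G (real i / 2 ^ m)) n \<omega>\<bar> + e * sqrt (real n * ln (ln (real n)))"
      using eventually_compose_filterlim[OF osc K] eventually_compose_filterlim[OF eventually_ge_at_top[of "m + 2"] K]
        ln small eventually_ge_at_top[of 3]
    proof eventually_elim
      case (elim n)
      define k where "k = K n"
      define w where "w = sqrt (real n * ln (ln (real n)))"
      have n: "0 < real n" using elim by simp
      have k: "m \<le> k" "2 \<le> k" using elim by (simp_all add: k_def)
      have lnk: "0 < ln (real k)" using k by simp
      have l: "0 \<le> log 4 (real n)" using elim by (simp add: zero_le_log_cancel_iff)
      have klog: "log 4 (real n) \<le> real k" "real k < log 4 (real n) + 1"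
        using l unfolding k_def K_def by linarith+
      have "real n \<le> 4 powr real k" using klog(1) n by (simp add: log_le_iff)
      then have n_le: "real n \<le> 4 ^ k" by (simp add: powr_realpow)
      have "4 powr (real k - 1) \<le> real n" using klog(2) n by (simp add: le_log_iff[symmetric])
      then have n_ge: "4 ^ k \<le> 4 * real n" by (simp add: powr_diff powr_realpow)
      have W: "sqrt (4 ^ k * ln (real k)) \<le> 4 * w"
      proof -
        have "ln (real k) \<le> ln (log 4 (real n) + 1)"
          using klog k by (subst ln_le_cancel_iff) auto
        then have "ln (real k) \<le> 4 * ln (ln (real n))" using elim(3) by linarith
        then have "4 ^ k * ln (real k) \<le> (4 * real n) * (4 * ln (ln (real n)))"
          using n_ge lnk by (intro mult_mono) auto
        then have "sqrt (4 ^ k * ln (real k)) \<le> sqrt (4\<^sup>2 * (real n * ln (ln (real n))))"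
          by (intro real_sqrt_le_mono) simp
        then show ?thesis by (simp only: w_def real_sqrt_mult real_sqrt_abs abs_numeral)
      qed
      have rest: "real n / 2 ^ k \<le> c * w"
      proof -
        have s: "sqrt (real n) \<le> 2 ^ k"
          using n_le by (intro real_le_lsqrt) (auto simp: power_mult[symmetric] power_mult_distrib[symmetric] power2_eq_square)
        have "real n / 2 ^ k = sqrt (real n) * (sqrt (real n) / 2 ^ k)" using n by simp
        also have "\<dots> \<le> sqrt (real n) * 1" using s by (intro mult_left_mono) auto
        also have "\<dots> \<le> sqrt (real n) * (c * sqrt (ln (ln (real n))))" using elim(4) by (intro mult_left_mono) auto
        also have "\<dots> = c * w" by (simp add: w_def real_sqrt_mult)
        finally show ?thesis .
      qed
      have geom: "(\<Sum>j\<in>{m<..k}. c * (3 / 4) ^ j * sqrt (4 ^ k * ln (real k))) \<le> 16 * c * w"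
      proof -
        have "(\<Sum>j\<in>{m<..k}. (3 / 4 :: real) ^ j) \<le> (\<Sum>j<Suc k. (3 / 4) ^ j)"
          by (intro sum_mono2) auto
        also have "\<dots> \<le> 4"
          by (subst sum_gp_strict) (simp add: field_simps)
        finally have g: "(\<Sum>j\<in>{m<..k}. (3 / 4 :: real) ^ j) \<le> 4" .
        have "(\<Sum>j\<in>{m<..k}. c * (3 / 4) ^ j * sqrt (4 ^ k * ln (real k))) =
            c * sqrt (4 ^ k * ln (real k)) * (\<Sum>j\<in>{m<..k}. (3 / 4) ^ j)"
          by (simp add: sum_distrib_left mult_ac)
        also have "\<dots> \<le> c * (4 * w) * 4"
        proof (intro mult_mono mult_left_mono W g)
          have "0 \<le> 4 * w" using order_trans[OF real_sqrt_ge_zero W] lnk by simp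
          then show "0 \<le> c * (4 * w)" using c by simp
        qed (use c lnk in \<open>auto intro: sum_nonneg\<close>)
        finally show ?thesis by simp
      qed
      show ?case
      proof
        fix t
        obtain i where i: "i \<le> 2 ^ k" "\<bar>real i / 2 ^ k - F t\<bar> \<le> 1 / 2 ^ k"
          "\<bar>dev {..t} n \<omega>\<bar> \<le> \<bar>dev (G (real i / 2 ^ k)) n \<omega>\<bar> + real n / 2 ^ k"
          using dev_sandwich by blast
        define d where "d = k - m"
        have kd: "k = m + d" using k by (simp add: d_def)
        define i' where "i' = i div 2 ^ d"
        have "\<bar>dev (G (real i / 2 ^ (m + d))) n \<omega> - dev (G (real (i div 2 ^ d) / 2 ^ m)) n \<omega>\<bar> \<le>
            (\<Sum>j\<in>{m<..m + d}. c * (3 / 4) ^ j * sqrt (4 ^ k * ln (real k)))"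
        proof (rule dyadic_chain)
          have "n \<le> 4 ^ k" using n_le by (metis of_nat_le_iff of_nat_numeral of_nat_power)
          then show "\<bar>dev (G ((real i + 1) / 2 ^ j)) n \<omega> - dev (G (real i / 2 ^ j)) n \<omega>\<bar> \<le> c * (3 / 4) ^ j * sqrt (4 ^ k * ln (real k))"
            if "m < j" "j \<le> m + d" "i < 2 ^ j" for j i
            using elim(1) that unfolding k_def[symmetric] kd[symmetric] by blast
          show "i \<le> 2 ^ (m + d)" using i(1) by (simp add: kd)
        qed (use c lnk in simp)
        then have chain: "\<bar>dev (G (real i / 2 ^ k)) n \<omega> - dev (G (real i' / 2 ^ m)) n \<omega>\<bar> \<le> 16 * c * w"
          using geom unfolding i'_def kd[symmetric] by linarith
        have "i' \<le> 2 ^ (m + d) div 2 ^ d" unfolding i'_def using i(1) by (intro div_le_mono) (simp add: kd)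
        then have i'_le: "i' \<le> 2 ^ m" by (simp add: power_add)
        have "\<bar>real i / 2 ^ k - real i' / 2 ^ m\<bar> \<le> 1 / 2 ^ m"
        proof -
          have "i = 2 ^ d * i' + i mod 2 ^ d" "i mod 2 ^ d < 2 ^ d" by (simp_all add: i'_def)
          then have "real i = 2 ^ d * real i' + real (i mod 2 ^ d)" "real (i mod 2 ^ d) \<le> 2 ^ d"
            by (metis of_nat_add of_nat_mult of_nat_numeral of_nat_power) (metis \<open>i mod 2 ^ d < 2 ^ d\<close> less_imp_le of_nat_le_iff of_nat_numeral of_nat_power)
          then have "real i / 2 ^ k - real i' / 2 ^ m = real (i mod 2 ^ d) / 2 ^ d / 2 ^ m"
            by (simp add: kd power_add field_simps)
          moreover have "real (i mod 2 ^ d) / 2 ^ d / 2 ^ m \<le> 1 / 2 ^ m"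
            using \<open>real (i mod 2 ^ d) \<le> 2 ^ d\<close> by (intro divide_right_mono) auto
          ultimately show ?thesis by simp
        qed
        moreover have "1 / 2 ^ k \<le> (1 / 2 ^ m :: real)"
          using k by (intro divide_left_mono power_increasing) auto
        ultimately have "\<bar>real i' / 2 ^ m - F t\<bar> \<le> 2 * e"
          using i(2) m by linarith
        moreover have "\<bar>dev {..t} n \<omega>\<bar> \<le> \<bar>dev (G (real i' / 2 ^ m)) n \<omega>\<bar> + e * w"
        proof -
          have "e * w = 16 * c * w + c * w" by (simp add: c_def)
          then show ?thesis using i(3) chain rest by linarith
        qed
        ultimately show "\<exists>i\<le>2 ^ m. \<bar>real i / 2 ^ m - F t\<bar> \<le> 2 * e \<and>
            \<bar>dev {..t} n \<omega>\<bar> \<le> \<bar>dev (G (real i / 2 ^ m)) n \<omega>\<bar> + e * sqrt (real n * ln (ln (real n)))"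
          using i'_le unfolding w_def by blast
      qed
    qed
  qed
  then show ?thesis using m by blast
qed

section \<open>The integrated empirical process\<close>

text \<open>Continuity of \<open>F\<close> makes single points null, so by Fubini the diagonal is
  null for the joint law of any two of the variables, and there are only countably many
  pairs.\<close>

lemma no_ties: "AE \<omega> in M. inj (\<lambda>n. Y n \<omega>)"
proof -
  have "AE \<omega> in M. Y i \<omega> \<noteq> Y j \<omega>" if "i \<noteq> j" for i j
  proof -
    have ind: "indep_var borel (Y i) borel (Y j)"
    proof -
      have "indep_var (PiM {i} (\<lambda>_. borel)) (\<lambda>\<omega>. restrict (\<lambda>i. Y i \<omega>) {i})
          (PiM {j} (\<lambda>_. borel)) (\<lambda>\<omega>. restrict (\<lambda>i. Y i \<omega>) {j})"
        using that by (intro indep_var_restrict[OF indep_Y]) auto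
      from indep_var_compose[OF this, of "\<lambda>f. f i" borel "\<lambda>f. f j" borel]
      show ?thesis by (simp add: comp_def measurable_component_singleton)
    qed
    have atom: "emeasure \<mu> {x} = 0" for x
      using cont_F D.isCont_cdf[of x]
      by (simp add: cdf_\<mu> continuous_on_eq_continuous_at D.emeasure_eq_measure)
    have diag: "{z \<in> space (\<mu> \<Otimes>\<^sub>M \<mu>). fst z = snd z} \<in> sets (\<mu> \<Otimes>\<^sub>M \<mu>)"
    proof -
      have "sets (\<mu> \<Otimes>\<^sub>M \<mu>) = sets (borel \<Otimes>\<^sub>M borel)" "space (\<mu> \<Otimes>\<^sub>M \<mu>) = space (borel \<Otimes>\<^sub>M borel)"
        by (auto intro!: sets_pair_measure_cong simp: space_pair_measure)
      moreover have "{z \<in> space (borel \<Otimes>\<^sub>M borel :: (real \<times> real) measure). fst z = snd z} \<in> sets (borel \<Otimes>\<^sub>M borel)"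
        by measurable
      ultimately show ?thesis by simp
    qed
    have "emeasure (\<mu> \<Otimes>\<^sub>M \<mu>) {z \<in> space (\<mu> \<Otimes>\<^sub>M \<mu>). fst z = snd z} = (\<integral>\<^sup>+x. emeasure \<mu> {x} \<partial>\<mu>)"
      unfolding D.emeasure_pair_measure_alt[OF diag]
      by (intro nn_integral_cong arg_cong[where f="emeasure \<mu>"]) (auto simp: space_pair_measure)
    then have "AE z in \<mu> \<Otimes>\<^sub>M \<mu>. fst z \<noteq> snd z"
      using diag by (intro AE_I[where N="{z \<in> space (\<mu> \<Otimes>\<^sub>M \<mu>). fst z = snd z}"]) (auto simp: atom)
    moreover have "\<mu> \<Otimes>\<^sub>M \<mu> = distr M (borel \<Otimes>\<^sub>M borel) (\<lambda>x. (Y i x, Y j x))"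
      using ind by (simp add: indep_var_distribution_eq distr_Y)
    ultimately have "AE z in distr M (borel \<Otimes>\<^sub>M borel) (\<lambda>x. (Y i x, Y j x)). fst z \<noteq> snd z"
      by metis
    then show ?thesis
      by (subst (asm) AE_distr_iff) auto
  qed
  then have "AE \<omega> in M. \<forall>i j. i \<noteq> j \<longrightarrow> Y i \<omega> \<noteq> Y j \<omega>"
    by (simp add: AE_all_countable)
  then show ?thesis by (rule AE_mp) (auto simp: inj_def)
qed

text \<open>The integral is a double sum over the observations up to \<open>t\<close>. Added to its
  transpose, it counts every ordered pair once and, in the absence of ties, the diagonal twice;
  hence \<open>N\<^sup>2 + N\<close>.\<close>

lemma integrated_emp_process_eq:
  fixes t :: real
  assumes n: "1 \<le> n" and inj: "inj (\<lambda>l. Y l \<omega>)" and X: "\<And>l. X (Suc l) \<omega> = Y l \<omega>"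
  defines "N \<equiv> F t * real n + dev {..t} n \<omega>"
  shows "integrated_emp_process X F n \<omega> t = sqrt (real n) * ((N\<^sup>2 + N) / (2 * (real n)\<^sup>2) - (F t)\<^sup>2 / 2)"
proof -
  define A where "A = {l \<in> {..<n}. Y l \<omega> \<le> t}"
  have fin: "finite A" by (simp add: A_def)
  have emp: "empirical_cdf X n \<omega> s = (1 / real n) * (\<Sum>l<n. indicator {..s} (Y l \<omega>))" for s
  proof -
    have "(\<Sum>i = 1..n. indicator {..s} (X i \<omega>)) = (\<Sum>l<n. indicator {..s} (Y l \<omega>) :: real)"
      by (simp add: sum.atLeast1_atMost_eq X)
    then show ?thesis by (simp add: empirical_cdf_def)
  qed
  have N: "N = real (card A)"
    by (simp add: N_def dev_def measure_atMost A_def indicator_def sum.If_cases Int_def)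
  let ?T = "\<Sum>j\<in>A. \<Sum>i\<in>A. of_bool (Y i \<omega> \<le> Y j \<omega>) :: real"
  have "?T + ?T = ?T + (\<Sum>j\<in>A. \<Sum>i\<in>A. of_bool (Y j \<omega> \<le> Y i \<omega>))"
    by (subst sum.swap) simp
  also have "\<dots> = (\<Sum>j\<in>A. \<Sum>i\<in>A. 1 + of_bool (i = j))"
    unfolding sum.distrib[symmetric] using inj
    by (intro sum.cong refl) (auto simp: inj_def)
  also have "\<dots> = N\<^sup>2 + N"
    using fin by (simp add: sum.distrib N power2_eq_square of_bool_def sum.delta distrib_left)
  finally have T: "?T = (N\<^sup>2 + N) / 2" by simp
  have "integrated_df (empirical_cdf X n \<omega>) t =
      (1 / real n) * (\<Sum>l<n. empirical_cdf X n \<omega> (Y l \<omega>) * indicator {..t} (Y l \<omega>))"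
    by (simp add: integrated_df_empirical_cdf[OF n] sum.atLeast1_atMost_eq X)
  also have "(\<Sum>l<n. empirical_cdf X n \<omega> (Y l \<omega>) * indicator {..t} (Y l \<omega>)) = (\<Sum>j\<in>A. empirical_cdf X n \<omega> (Y j \<omega>))"
    unfolding A_def by (intro sum.mono_neutral_cong_right) auto
  also have "\<dots> = (\<Sum>j\<in>A. (1 / real n) * (\<Sum>i\<in>A. of_bool (Y i \<omega> \<le> Y j \<omega>)))"
  proof (intro sum.cong refl)
    fix j assume "j \<in> A"
    then have "(\<Sum>l<n. indicator {..Y j \<omega>} (Y l \<omega>)) = (\<Sum>i\<in>A. of_bool (Y i \<omega> \<le> Y j \<omega>) :: real)"
      unfolding A_def by (intro sum.mono_neutral_cong_right) (auto simp: indicator_def)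
    then show "empirical_cdf X n \<omega> (Y j \<omega>) = (1 / real n) * (\<Sum>i\<in>A. of_bool (Y i \<omega> \<le> Y j \<omega>))"
      by (simp add: emp)
  qed
  also have "\<dots> = (1 / real n) * ?T" by (simp add: sum_distrib_left)
  finally have "integrated_df (empirical_cdf X n \<omega>) t = (N\<^sup>2 + N) / (2 * (real n)\<^sup>2)"
    by (simp add: T power2_eq_square)
  moreover have "integrated_df F t = (F t)\<^sup>2 / 2"
    using D.integrated_df_continuous_cdf[of t] cont_F by (simp add: cdf_\<mu>)
  ultimately show ?thesis by (simp add: integrated_emp_process_def)
qed

end

section \<open>The extremal weight and the two almost sure bounds\<close>

text \<open>After squaring, the claim is that \<open>u ^ 3 * (1 - u)\<close> is at most its value
  \<open>27 / 256\<close> at \<open>3 / 4\<close>. The difference has a double root at this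
  maximiser, and the remaining quadratic factor is a positive sum of squares.\<close>

lemma weight_bound:
  fixes u :: real
  assumes "0 \<le> u" "u \<le> 1"
  shows "u * sqrt (2 * (u * (1 - u))) \<le> 3 * sqrt 3 / (8 * sqrt 2)"
proof (rule power2_le_imp_le)
  have "27 / 256 - u ^ 3 * (1 - u) = (u - 3 / 4)\<^sup>2 * ((u + 1 / 4)\<^sup>2 + 1 / 8)"
    by (simp add: power2_eq_square power3_eq_cube algebra_simps)
  moreover have "0 \<le> (u - 3 / 4)\<^sup>2 * ((u + 1 / 4)\<^sup>2 + 1 / 8)" by simp
  ultimately have "2 * (u ^ 3 * (1 - u)) \<le> 27 / 128" by linarith
  moreover have "(u * sqrt (2 * (u * (1 - u))))\<^sup>2 = 2 * (u ^ 3 * (1 - u))"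
    using assms by (simp add: power_mult_distrib power2_eq_square power3_eq_cube)
  moreover have "(3 * sqrt 3 / (8 * sqrt 2))\<^sup>2 = (27 / 128 :: real)"
    by (simp add: power_mult_distrib power_divide)
  ultimately show "(u * sqrt (2 * (u * (1 - u))))\<^sup>2 \<le> (3 * sqrt 3 / (8 * sqrt 2))\<^sup>2"
    by simp
qed simp

context iid_continuous
begin

text \<open>On the finite grid the law of the iterated logarithm holds simultaneously, and there
  \<open>weight_bound\<close> applies. The unweighted second bound serves the quadratic term in the
  expansion of the process.\<close>

lemma weighted_dev_upper:
  defines "c \<equiv> 3 * sqrt 3 / (8 * sqrt 2)"
  assumes e: "0 < e" "e \<le> 1"
  shows "AE \<omega> in M. \<forall>\<^sub>F n in sequentially. \<forall>t.
    F t * \<bar>dev {..t} n \<omega>\<bar> \<le> (c + 6 * e) * sqrt (real n * ln (ln (real n))) \<and>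
    \<bar>dev {..t} n \<omega>\<bar> \<le> 3 * sqrt (real n * ln (ln (real n)))"
proof -
  have c1: "c \<le> 1"
  proof (rule power2_le_imp_le)
    show "c\<^sup>2 \<le> 1\<^sup>2" by (simp add: c_def power_mult_distrib power_divide)
  qed simp
  obtain m where m: "AE \<omega> in M. \<forall>\<^sub>F n in sequentially. \<forall>t. \<exists>i\<le>2 ^ m.
    \<bar>real i / 2 ^ m - F t\<bar> \<le> 2 * e \<and>
    \<bar>dev {..t} n \<omega>\<bar> \<le> \<bar>dev (G (real i / 2 ^ m)) n \<omega>\<bar> + e * sqrt (real n * ln (ln (real n)))"
    using uniform_approx[OF e(1)] by blast
  define u where "u i = real i / 2 ^ m" for i :: nat
  have u: "0 \<le> u i" "u i \<le> 1" if "i \<le> 2 ^ m" for i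
  proof -
    have "real i \<le> 2 ^ m" using that by (metis of_nat_le_iff of_nat_numeral of_nat_power)
    then show "0 \<le> u i" "u i \<le> 1" by (simp_all add: u_def)
  qed
  have "AE \<omega> in M. \<forall>i\<in>{..2 ^ m}. \<forall>\<^sub>F n in sequentially.
      \<bar>dev (G (u i)) n \<omega>\<bar> \<le> (1 + e) * sqrt (2 * (u i * (1 - u i)) * real n * ln (ln (real n)))"
  proof (rule AE_ball_countable[THEN iffD2], simp, intro ballI)
    fix i :: nat assume "i \<in> {..2 ^ m}"
    with dev_lil_upper[OF G_sets e(1), of "u i"] u[of i]
    show "AE \<omega> in M. \<forall>\<^sub>F n in sequentially.
      \<bar>dev (G (u i)) n \<omega>\<bar> \<le> (1 + e) * sqrt (2 * (u i * (1 - u i)) * real n * ln (ln (real n)))"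
      by (simp add: measure_G)
  qed
  with m show ?thesis
  proof eventually_elim
    case (elim \<omega>)
    have "\<forall>\<^sub>F n in sequentially. \<forall>i\<in>{..2 ^ m}.
      \<bar>dev (G (u i)) n \<omega>\<bar> \<le> (1 + e) * sqrt (2 * (u i * (1 - u i)) * real n * ln (ln (real n)))"
      using elim(2) by (intro eventually_ball_finite) auto
    with elim(1) show ?case
      using eventually_ge_at_top[of 3]
    proof eventually_elim
      case (elim n)
      define w where "w = sqrt (real n * ln (ln (real n)))"
      have "1 \<le> ln (real n)" using elim(3) exp_le by (subst ln_ge_iff) auto
      then have w: "0 \<le> w" by (simp add: w_def)
      show ?case
      proof
        fix t
        obtain i where i: "i \<le> 2 ^ m" "\<bar>u i - F t\<bar> \<le> 2 * e"
          "\<bar>dev {..t} n \<omega>\<bar> \<le> \<bar>dev (G (u i)) n \<omega>\<bar> + e * w"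
          using elim(1) unfolding u_def w_def by blast
        define s where "s = sqrt (2 * (u i * (1 - u i)))"
        have s0: "0 \<le> s" using u[OF i(1)] by (simp add: s_def)
        have s1: "s \<le> 1"
        proof -
          have "2 * (u i * (1 - u i)) = 1 / 2 - 2 * (u i - 1 / 2)\<^sup>2"
            by (simp add: power2_eq_square algebra_simps)
          also have "\<dots> \<le> 1" using zero_le_power2[of "u i - 1 / 2"] by linarith
          finally show ?thesis by (simp add: s_def)
        qed
        have us: "u i * s \<le> c" unfolding s_def c_def by (rule weight_bound[OF u[OF i(1)]])
        have "\<bar>dev (G (u i)) n \<omega>\<bar> \<le> (1 + e) * sqrt (2 * (u i * (1 - u i)) * real n * ln (ln (real n)))"
          using elim(2) i(1) by simp
        also have "\<dots> = (1 + e) * (s * w)"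
          unfolding s_def w_def real_sqrt_mult[symmetric] by (simp only: mult.assoc)
        finally have h: "\<bar>dev (G (u i)) n \<omega>\<bar> \<le> (1 + e) * (s * w)" .
        have sw: "s * w \<le> w" "0 \<le> s * w" using s0 s1 w by (simp_all add: mult_left_le_one_le)
        have d: "\<bar>dev {..t} n \<omega>\<bar> \<le> (1 + e) * (s * w) + e * w" using i(3) h by linarith
        have ew: "e * w \<le> w" "e * (s * w) \<le> e * w" "e * (s * w) \<le> s * w"
          using e sw w by (auto intro: mult_left_mono simp: mult_left_le_one_le)
        have "(1 + e) * (s * w) + e * w \<le> 3 * w"
          using sw ew by (simp add: distrib_right)
        moreover have "F t * \<bar>dev {..t} n \<omega>\<bar> \<le> (c + 6 * e) * w"
        proof -
          \<comment> \<open>Origin of \<open>6 * e\<close>: one \<open>e\<close> from the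
            approximation error, one from the factor \<open>1 + e\<close> in front of
            \<open>c \<le> 1\<close>, and four from moving the weight by \<open>2 * e\<close>
            against a deviation of at most \<open>2 * w\<close>.\<close>
          have "F t * \<bar>dev {..t} n \<omega>\<bar> \<le> F t * ((1 + e) * (s * w)) + F t * (e * w)"
            using d F_bounds[of t] by (simp add: distrib_left[symmetric] mult_left_mono)
          also have "F t * (e * w) \<le> e * w"
            using F_bounds[of t] e w by (intro mult_left_le_one_le) auto
          also have "F t * ((1 + e) * (s * w)) \<le> (u i + 2 * e) * ((1 + e) * (s * w))"
            using i(2) e sw by (intro mult_right_mono) auto
          also have "\<dots> = (1 + e) * (u i * s * w) + 2 * e * ((1 + e) * (s * w))"
            by (simp add: algebra_simps)
          also have "(1 + e) * (u i * s * w) \<le> (1 + e) * (c * w)"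
            using us e w by (intro mult_left_mono mult_right_mono) auto
          also have "\<dots> \<le> c * w + e * w"
            using mult_right_mono[OF c1 w] mult_left_mono[OF mult_right_mono[OF c1 w], of e] e
            by (simp add: distrib_right)
          also have "2 * e * ((1 + e) * (s * w)) \<le> 2 * e * (2 * w)"
            using e sw ew by (intro mult_left_mono) (auto simp: distrib_right)
          finally show ?thesis by (simp add: distrib_right)
        qed
        ultimately show "F t * \<bar>dev {..t} n \<omega>\<bar> \<le> (c + 6 * e) * sqrt (real n * ln (ln (real n))) \<and>
            \<bar>dev {..t} n \<omega>\<bar> \<le> 3 * sqrt (real n * ln (ln (real n)))"
          using d unfolding w_def[symmetric] by linarith
      qed
    qed
  qed
qed

text \<open>Substituting \<open>N = F t * n + dev\<close> cancels the centring. The term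
  \<open>r\<close> is \<open>N / (2 * n * sqrt n)\<close>, the contribution of the diagonal pairs.
  Both correction terms are nonnegative, so lower bounds may drop them.\<close>

lemma integrated_emp_process_expand:
  fixes t :: real
  assumes n: "1 \<le> n" and inj: "inj (\<lambda>l. Y l \<omega>)" and X: "\<And>l. X (Suc l) \<omega> = Y l \<omega>"
  obtains r where "0 \<le> r" "r \<le> 1 / (2 * sqrt (real n))"
    and "integrated_emp_process X F n \<omega> t =
      F t * dev {..t} n \<omega> / sqrt (real n) + (dev {..t} n \<omega>)\<^sup>2 / (2 * (real n * sqrt (real n))) + r"
proof
  let ?s = "sqrt (real n)"
  define N where "N = F t * real n + dev {..t} n \<omega>"
  let ?r = "N / (2 * (real n * ?s))"
  have N: "N = (\<Sum>l<n. indicator {..t} (Y l \<omega>))"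
    by (simp add: N_def dev_def measure_atMost)
  have N0: "0 \<le> N" unfolding N by (intro sum_nonneg) simp
  have Nn: "N \<le> real n"
    unfolding N using sum_mono[of "{..<n}" "\<lambda>l. indicator {..t} (Y l \<omega>)" "\<lambda>_. 1 :: real"]
    by (simp add: indicator_def)
  show "0 \<le> ?r" using N0 by simp
  have s: "0 < ?s" "real n = ?s * ?s" using n by simp_all
  show "?r \<le> 1 / (2 * ?s)"
    using Nn n s(1) by (simp add: divide_simps)
  have "integrated_emp_process X F n \<omega> t = ?s * ((N\<^sup>2 + N) / (2 * (real n)\<^sup>2) - (F t)\<^sup>2 / 2)"
    unfolding N_def by (rule integrated_emp_process_eq[where X=X, OF n inj X])
  also have "N\<^sup>2 = (F t)\<^sup>2 * (real n)\<^sup>2 + 2 * (F t * dev {..t} n \<omega>) * real n + (dev {..t} n \<omega>)\<^sup>2"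
    by (simp add: N_def power2_eq_square algebra_simps)
  also have "?s * (((F t)\<^sup>2 * (real n)\<^sup>2 + 2 * (F t * dev {..t} n \<omega>) * real n + (dev {..t} n \<omega>)\<^sup>2 + N) / (2 * (real n)\<^sup>2) - (F t)\<^sup>2 / 2) =
      F t * dev {..t} n \<omega> / ?s + (dev {..t} n \<omega>)\<^sup>2 / (2 * (real n * ?s)) + ?r"
  proof -
    define q where "q = ?s"
    have q: "q \<noteq> 0" "real n = q * q" using s by (simp_all add: q_def)
    show ?thesis
      unfolding q_def[symmetric] unfolding q(2) using q(1) by (simp add: field_simps power2_eq_square)
  qed
  finally show "integrated_emp_process X F n \<omega> t =
      F t * dev {..t} n \<omega> / ?s + (dev {..t} n \<omega>)\<^sup>2 / (2 * (real n * ?s)) + ?r" .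
qed

lemma process_upper:
  assumes e: "0 < e" "e \<le> 1" and X: "\<And>l \<omega>. X (Suc l) \<omega> = Y l \<omega>"
  shows "AE \<omega> in M. \<forall>\<^sub>F n in sequentially.
    (SUP t. \<bar>integrated_emp_process X F n \<omega> t\<bar>) \<le> (3 * sqrt 3 / (8 * sqrt 2) + 8 * e) * sqrt (ln (ln (real n)))"
  using weighted_dev_upper[OF e] no_ties
proof eventually_elim
  case (elim \<omega>)
  \<comment> \<open>Each correction term is charged one \<open>e\<close>, which raises
    \<open>6 * e\<close> to \<open>8 * e\<close>; the \<open>9\<close> is the square of the constant
    in the unweighted bound.\<close>
  have "\<forall>\<^sub>F n in sequentially. 9 * ln (ln (real n)) / (2 * sqrt (real n)) \<le> e * sqrt (ln (ln (real n)))"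
    using e by real_asymp
  moreover have "\<forall>\<^sub>F n in sequentially. 1 / (2 * sqrt (real n)) \<le> e * sqrt (ln (ln (real n)))"
    using e by real_asymp
  ultimately show ?case
    using elim(1) eventually_ge_at_top[of 3]
  proof eventually_elim
    case (elim n)
    let ?s = "sqrt (real n)" and ?L = "ln (ln (real n))" and ?c = "3 * sqrt 3 / (8 * sqrt 2)"
    have s: "0 < ?s" using elim by simp
    have "1 \<le> ln (real n)" using elim(4) exp_le by (subst ln_ge_iff) auto
    then have L: "0 \<le> ?L" by simp
    show ?case
    proof (rule cSUP_least)
      fix t
      let ?d = "dev {..t} n \<omega>"
      obtain r where r: "0 \<le> r" "r \<le> 1 / (2 * ?s)"
        and eq: "integrated_emp_process X F n \<omega> t = F t * ?d / ?s + ?d\<^sup>2 / (2 * (real n * ?s)) + r"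
        using integrated_emp_process_expand[of n \<omega> X t] elim(4) \<open>inj (\<lambda>n. Y n \<omega>)\<close> X by auto
      have d: "F t * \<bar>?d\<bar> \<le> (?c + 6 * e) * (?s * sqrt ?L)" "\<bar>?d\<bar> \<le> 3 * (?s * sqrt ?L)"
        using elim(3) by (simp_all add: real_sqrt_mult)
      have "\<bar>F t * ?d / ?s\<bar> = F t * \<bar>?d\<bar> / ?s"
        using F_bounds[of t] by (simp add: abs_mult)
      also have "\<dots> \<le> (?c + 6 * e) * (?s * sqrt ?L) / ?s"
        using d(1) s by (intro divide_right_mono) auto
      also have "\<dots> = (?c + 6 * e) * sqrt ?L" using s by simp
      finally have 1: "\<bar>F t * ?d / ?s\<bar> \<le> (?c + 6 * e) * sqrt ?L" .
      have "?d\<^sup>2 \<le> (3 * (?s * sqrt ?L))\<^sup>2"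
        using d(2) by (metis abs_ge_zero power2_abs power_mono)
      also have "\<dots> = real n * (9 * ?L)" using L by (simp add: power_mult_distrib)
      finally have "?d\<^sup>2 / (2 * (real n * ?s)) \<le> real n * (9 * ?L) / (2 * (real n * ?s))"
        using s by (intro divide_right_mono) auto
      also have "\<dots> = 9 * ?L / (2 * ?s)" using s by simp
      finally have 2: "?d\<^sup>2 / (2 * (real n * ?s)) \<le> e * sqrt ?L" using elim(1) by linarith
      have "0 \<le> ?d\<^sup>2 / (2 * (real n * ?s))" by simp
      then have "\<bar>integrated_emp_process X F n \<omega> t\<bar> \<le> (?c + 6 * e) * sqrt ?L + e * sqrt ?L + e * sqrt ?L"
        unfolding eq using 1 2 r elim(2) by linarith
      then show "\<bar>integrated_emp_process X F n \<omega> t\<bar> \<le> (?c + 8 * e) * sqrt ?L"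
        by (simp add: algebra_simps)
    qed simp
  qed
qed

text \<open>A single point suffices, namely one where \<open>F\<close> equals the maximiser
  \<open>3 / 4\<close> of the weight. There the variance is \<open>3 / 16\<close>, and the one-sided
  law is enough because the corrections only help.\<close>

lemma process_lower:
  assumes e: "0 < e" "e \<le> 1" and X: "\<And>l \<omega>. X (Suc l) \<omega> = Y l \<omega>"
  shows "AE \<omega> in M. \<exists>\<^sub>F n in sequentially.
    (1 - e) * (3 * sqrt 3 / (8 * sqrt 2)) * sqrt (ln (ln (real n))) \<le> (SUP t. \<bar>integrated_emp_process X F n \<omega> t\<bar>)"
proof -
  obtain t where t: "F t = 3 / 4" by (rule F_surj[of "3 / 4"]) auto
  have "AE \<omega> in M. \<exists>\<^sub>F n in sequentially. (1 - e) * sqrt (2 * (3 / 16) * real n * ln (ln (real n))) \<le> dev {..t} n \<omega>"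
    using dev_lil_lower[of "{..t}" e] e by (simp add: measure_atMost t)
  with no_ties show ?thesis
  proof eventually_elim
    case (elim \<omega>)
    have "\<forall>\<^sub>F n in sequentially. (1 - e) * sqrt (2 * (3 / 16) * real n * ln (ln (real n))) \<le> dev {..t} n \<omega> \<longrightarrow>
      (1 - e) * (3 * sqrt 3 / (8 * sqrt 2)) * sqrt (ln (ln (real n))) \<le> (SUP t. \<bar>integrated_emp_process X F n \<omega> t\<bar>)"
      using eventually_ge_at_top[of 3]
    proof eventually_elim
      case (elim n)
      let ?d = "dev {..t} n \<omega>" and ?s = "sqrt (real n)" and ?L = "ln (ln (real n))"
      show ?case
      proof
        assume d: "(1 - e) * sqrt (2 * (3 / 16) * real n * ?L) \<le> ?d"
        have n: "1 \<le> n" using elim by simp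
        have s: "0 < ?s" using elim by simp
        obtain r where r: "0 \<le> r"
          and eq: "integrated_emp_process X F n \<omega> t = F t * ?d / ?s + ?d\<^sup>2 / (2 * (real n * ?s)) + r"
          using integrated_emp_process_expand[where X=X and t=t, OF n \<open>inj (\<lambda>n. Y n \<omega>)\<close> X] by blast
        have c: "3 / 4 * sqrt (2 * (3 / 16)) = 3 * sqrt 3 / (8 * sqrt 2 :: real)"
        proof (rule power2_eq_imp_eq)
          show "(3 / 4 * sqrt (2 * (3 / 16)))\<^sup>2 = (3 * sqrt 3 / (8 * sqrt 2 :: real))\<^sup>2"
            by (simp add: power_mult_distrib power_divide)
        qed auto
        have "(1 - e) * (3 * sqrt 3 / (8 * sqrt 2)) * sqrt ?L = 3 / 4 * ((1 - e) * sqrt (2 * (3 / 16) * real n * ?L)) / ?s"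
        proof -
          have "sqrt (2 * (3 / 16) * real n * ?L) = sqrt (2 * (3 / 16)) * (?s * sqrt ?L)"
            by (simp only: real_sqrt_mult mult.assoc)
          then show ?thesis unfolding c[symmetric] using s by simp
        qed
        also have "\<dots> \<le> F t * ?d / ?s"
          unfolding t using d s by (intro divide_right_mono mult_left_mono) auto
        also have "\<dots> \<le> integrated_emp_process X F n \<omega> t"
          unfolding eq using r by simp
        also have "\<dots> \<le> \<bar>integrated_emp_process X F n \<omega> t\<bar>" by simp
        also have "\<dots> \<le> (SUP t. \<bar>integrated_emp_process X F n \<omega> t\<bar>)"
          using bdd_above_integrated_emp_process[OF n D.real_distribution_axioms]
          by (intro cSUP_upper) (simp_all add: cdf_\<mu>)
        finally show "(1 - e) * (3 * sqrt 3 / (8 * sqrt 2)) * sqrt ?L \<le> (SUP t. \<bar>integrated_emp_process X F n \<omega> t\<bar>)" .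
      qed
    qed
    then show ?case by (rule frequently_rev_mp[OF elim(2)])
  qed
qed

lemma limsup_process:
  assumes X: "\<And>l \<omega>. X (Suc l) \<omega> = Y l \<omega>"
  shows "AE \<omega> in M. limsup (\<lambda>n. ereal ((SUP t. \<bar>integrated_emp_process X F n \<omega> t\<bar>) / sqrt (ln (ln (real n)))))
    = ereal (3 * sqrt 3 / (8 * sqrt 2))"
proof -
  define c :: real where "c = 3 * sqrt 3 / (8 * sqrt 2)"
  have c: "0 < c" by (simp add: c_def)
  \<comment> \<open>Restricting the tolerance to \<open>1 / Suc j\<close> leaves countably many
    exceptional sets, with a null union.\<close>
  have "AE \<omega> in M. \<forall>j::nat. \<forall>\<^sub>F n in sequentially.
      (SUP t. \<bar>integrated_emp_process X F n \<omega> t\<bar>) \<le> (c + 8 * (1 / real (Suc j))) * sqrt (ln (ln (real n)))"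
    unfolding AE_all_countable c_def by (intro allI process_upper X) auto
  moreover have "AE \<omega> in M. \<forall>j::nat. \<exists>\<^sub>F n in sequentially.
      (1 - 1 / real (Suc j)) * c * sqrt (ln (ln (real n))) \<le> (SUP t. \<bar>integrated_emp_process X F n \<omega> t\<bar>)"
    unfolding AE_all_countable c_def by (intro allI process_lower X) auto
  ultimately show ?thesis
  proof eventually_elim
    case (elim \<omega>)
    let ?f = "\<lambda>n. (SUP t. \<bar>integrated_emp_process X F n \<omega> t\<bar>)" and ?L = "\<lambda>n::nat. sqrt (ln (ln (real n)))"
    \<comment> \<open>For \<open>n \<le> 2\<close> the norming is zero or negative under the
      conventions for \<open>ln\<close> and \<open>sqrt\<close>; the upper limit ignores these
      terms.\<close>
    have L: "\<forall>\<^sub>F n in sequentially. 0 < ?L n" by real_asymp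
    have small: "\<exists>j. a * (1 / real (Suc j)) < e" if ea: "0 < e" "0 < a" for a e :: real
    proof -
      obtain j where "inverse (real (Suc j)) < e / a" using reals_Archimedean[OF divide_pos_pos[OF ea]] ..
      then show ?thesis using ea by (auto simp: field_simps intro!: exI[of _ j])
    qed
    have "limsup (\<lambda>n. ereal (?f n / ?L n)) = ereal c"
    proof (rule antisym)
      show "limsup (\<lambda>n. ereal (?f n / ?L n)) \<le> ereal c"
      proof (rule ereal_le_epsilon2)
        fix e :: real assume "0 < e"
        then obtain j where j: "8 * (1 / real (Suc j)) < e" using small[of e 8] by auto
        have "\<forall>\<^sub>F n in sequentially. ereal (?f n / ?L n) \<le> ereal (c + e)"
          using elim(1)[rule_format, of j] L
        proof eventually_elim
          case (elim n)
          have "?f n \<le> (c + e) * ?L n"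
            by (rule order_trans[OF elim(1)]) (use j elim(2) in \<open>intro mult_right_mono, auto\<close>)
          then show ?case using elim(2) by (simp add: pos_divide_le_eq)
        qed
        then have "limsup (\<lambda>n. ereal (?f n / ?L n)) \<le> ereal (c + e)" by (rule Limsup_bounded)
        then show "limsup (\<lambda>n. ereal (?f n / ?L n)) \<le> ereal c + ereal e" by simp
      qed
      show "ereal c \<le> limsup (\<lambda>n. ereal (?f n / ?L n))"
      proof (rule ereal_le_epsilon2)
        fix e :: real assume "0 < e"
        then obtain j where j: "c * (1 / real (Suc j)) < e" using small[of e c] c by auto
        have "ereal (c - e) \<le> limsup (\<lambda>n. ereal (?f n / ?L n))"
        proof (rule ccontr)
          assume "\<not> ereal (c - e) \<le> limsup (\<lambda>n. ereal (?f n / ?L n))"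
          then have "\<forall>\<^sub>F n in sequentially. ereal (?f n / ?L n) < ereal (c - e)"
            by (intro Limsup_le_iff[THEN iffD1, OF order_refl, rule_format]) (simp add: not_le)
          with L have "\<forall>\<^sub>F n in sequentially. \<not> (1 - 1 / real (Suc j)) * c * ?L n \<le> ?f n"
          proof eventually_elim
            case (elim n)
            then have "?f n < (c - e) * ?L n" by (simp add: pos_divide_less_eq)
            also have "\<dots> \<le> (1 - 1 / real (Suc j)) * c * ?L n"
              using j elim(1) by (intro mult_right_mono) (auto simp: algebra_simps)
            finally show ?case by simp
          qed
          then show False using elim(2)[rule_format, of j] by (simp add: frequently_def)
        qed
        then have "ereal (c - e) + ereal e \<le> limsup (\<lambda>n. ereal (?f n / ?L n)) + ereal e"
          by (rule add_right_mono)
        then show "ereal c \<le> limsup (\<lambda>n. ereal (?f n / ?L n)) + ereal e" by simp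
      qed
    qed
    then show ?case by (simp add: c_def)
  qed
qed

end

theorem corollary2p6:
  fixes M :: "'a measure" and X :: "nat \<Rightarrow> 'a \<Rightarrow> real" and F :: "real \<Rightarrow> real"
  assumes "prob_space M"
    and indep: "prob_space.indep_vars M (\<lambda>_. borel) X {1..}"
    and ident: "\<And>i. i \<ge> 1 \<Longrightarrow> cdf (distr M borel (X i)) = F"
    and cont: "continuous_on UNIV F"
  shows "AE \<omega> in M.
    limsup (\<lambda>n. ereal ((SUP t. \<bar>integrated_emp_process X F n \<omega> t\<bar>) / sqrt (ln (ln (real n)))))
      = ereal (3 * sqrt 3 / (8 * sqrt 2))"
proof -
  interpret prob_space M by fact
  have "indep_vars (\<lambda>_. borel) (\<lambda>l. X (Suc l)) UNIV"
  proof -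
    \<comment> \<open>Independence of the restrictions to the disjoint singletons
      \<open>{Suc j}\<close> amounts to reindexing the family from \<open>{1..}\<close> to all
      naturals.\<close>
    have "indep_vars (\<lambda>j. PiM {Suc j} (\<lambda>_. borel)) (\<lambda>j \<omega>. restrict (\<lambda>i. X i \<omega>) {Suc j}) UNIV"
      by (rule indep_vars_restrict[OF indep]) (auto simp: disjoint_family_on_def)
    from indep_vars_compose2[OF this, of "\<lambda>j f. f (Suc j)" "\<lambda>_. borel"]
    show ?thesis by (simp add: measurable_component_singleton)
  qed
  then interpret iid_continuous M "\<lambda>l. X (Suc l)" F
    by unfold_locales (simp_all add: ident cont)
  show ?thesis by (rule limsup_process) simp
qed

end
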